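(* Let $\Psi=\Psi(s,t)$ be a solution of the Betchov-Da Rios equation $\Psi_t=\Psi_s\times\Psi_{ss}\times\Psi_{sss}$ in $E^4$ (with unit speed $s$-parameter curves), with its parallel transport frame field. The soliton surface $S:\Psi=\Psi(s,t)$ is flat if and only if $\mathcal{A}\mathcal{W}^2=Q^2\mathcal{C}^2$ holds.
   Context: Setting. $E^4$ is $\mathbb{R}^4$ with its standard inner product $\langle\cdot,\cdot\rangle$ and orientation; the ternary vector product $x\times y\times z$ is the formal determinant of the $4\times4$ matrix whose first row is the standard basis $(e_1,e_2,e_3,e_4)$ and whose remaining rows are $x,y,z$. Subscripts $s,t$ denote partial derivatives. $\Psi=\Psi(s,t)$ is a smooth map from a product of two open intervals to $E^4$ whose $s$-parameter curves $s\mapsto\Psi(s,t)$ are unit speed for all $t$. A parallel transport frame field is a smooth positively oriented orthonormal frame $\{\mathcal{T},\mathcal{P}_1,\mathcal{P}_2,\mathcal{P}_3\}$ along $\Psi$ with $\mathcal{T}=\Psi_s$, $\mathcal{T}_s=k_1\mathcal{P}_1+k_2\mathcal{P}_2+k_3\mathcal{P}_3$ and $(\mathcal{P}_i)_s=-k_i\mathcal{T}$; $k_1,k_2,k_3$ are its curvature functions. Put $\mathfrak{a}_{23}=\langle(\mathcal{P}_1)_t,\mathcal{P}_2\rangle$, $\mathfrak{a}_{24}=\langle(\mathcal{P}_1)_t,\mathcal{P}_3\rangle$, $\mathfrak{a}_{34}=\langle(\mathcal{P}_2)_t,\mathcal{P}_3\rangle$, $P=k_3(k_2)_s-k_2(k_3)_s$,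 $R=k_1(k_3)_s-k_3(k_1)_s$, $S=k_2(k_1)_s-k_1(k_2)_s$ (the function $S$ is not to be confused with the surface), $Q=\sqrt{k_1^2+k_2^2+k_3^2}$, $\mathcal{W}=\sqrt{P^2+R^2+S^2}$, and $\mathcal{A}=(Pk_3-Sk_1)\mathfrak{a}_{24}+(Pk_2-Rk_1)\mathfrak{a}_{23}+(Rk_3-Sk_2)\mathfrak{a}_{34}-R(k_2)_t-S(k_3)_t-P(k_1)_t$, $\mathcal{C}=(k_1)_sP_s+(k_2)_sR_s+(k_3)_sS_s$. Standing assumptions: at least two of $k_1,k_2,k_3$ are non-zero, and $P,R,S$ are not all zero at any point. A surface is flat if its Gaussian curvature $K=\det(A_{N_1})+\det(A_{N_2})$ vanishes identically, where $A_{N_1},A_{N_2}$ are the shape operators with respect to an orthonormal frame $N_1,N_2$ of the normal bundle. The equation in the claim is an identity of functions of $(s,t)$. *)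

theory Defs
  imports "HOL-Analysis.Analysis"
begin

(* Functions of the two parameters are written as functions of a point p = (s, t). *)

definition partial_s :: "(real \<times> real \<Rightarrow> 'a::real_normed_vector) \<Rightarrow> real \<times> real \<Rightarrow> 'a" where
  "partial_s f p = vector_derivative (\<lambda>s. f (s, snd p)) (at (fst p))"

definition partial_t :: "(real \<times> real \<Rightarrow> 'a::real_normed_vector) \<Rightarrow> real \<times> real \<Rightarrow> 'a" where
  "partial_t f p = vector_derivative (\<lambda>t. f (fst p, t)) (at (snd p))"

(* Only meaningful on open sets, since it uses the unrestricted filter (at x). *)
fun times_differentiable_on ::
  "nat \<Rightarrow> 'a::real_normed_vector set \<Rightarrow> ('a \<Rightarrow> 'b::real_normed_vector) \<Rightarrow> bool" where
  "times_differentiable_on 0 U f \<longleftrightarrow> continuous_on U f"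
| "times_differentiable_on (Suc n) U f \<longleftrightarrow>
     (\<forall>x\<in>U. f differentiable (at x)) \<and>
     (\<forall>v. times_differentiable_on n U (\<lambda>x. frechet_derivative f (at x) v))"

definition smooth_on :: "'a::real_normed_vector set \<Rightarrow> ('a \<Rightarrow> 'b::real_normed_vector) \<Rightarrow> bool" where
  "smooth_on U f \<longleftrightarrow> (\<forall>n. times_differentiable_on n U f)"

definition open_interval :: "real set \<Rightarrow> bool" where
  "open_interval I \<longleftrightarrow> open I \<and> is_interval I \<and> I \<noteq> {}"

(* The i-th coordinate is the coefficient of e_i in the formal determinant with first row
   (e_1, e_2, e_3, e_4), that is, the determinant with first row the i-th unit vector. *)
definition ternary_product :: "real^4 \<Rightarrow> real^4 \<Rightarrow> real^4 \<Rightarrow> real^4" where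
  "ternary_product x y z = (\<chi> i. det (vector [axis i 1, x, y, z] :: real^4^4))"

definition betchov_da_rios :: "(real \<times> real) set \<Rightarrow> (real \<times> real \<Rightarrow> real^4) \<Rightarrow> bool" where
  "betchov_da_rios U \<Psi> \<longleftrightarrow>
     (\<forall>p\<in>U. partial_t \<Psi> p =
        ternary_product (partial_s \<Psi> p) (partial_s (partial_s \<Psi>) p)
          (partial_s (partial_s (partial_s \<Psi>)) p))"

definition positive_orthonormal_frame :: "real^4 \<Rightarrow> real^4 \<Rightarrow> real^4 \<Rightarrow> real^4 \<Rightarrow> bool" where
  "positive_orthonormal_frame a b c d \<longleftrightarrow>
     norm a = 1 \<and> norm b = 1 \<and> norm c = 1 \<and> norm d = 1 \<and>
     a \<bullet> b = 0 \<and> a \<bullet> c = 0 \<and> a \<bullet> d = 0 \<and> b \<bullet> c = 0 \<and> b \<bullet> d = 0 \<and> c \<bullet> d = 0 \<and>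
     det (vector [a, b, c, d] :: real^4^4) > 0"

definition parallel_transport_frame ::
  "(real \<times> real) set \<Rightarrow> (real \<times> real \<Rightarrow> real^4) \<Rightarrow>
   (real \<times> real \<Rightarrow> real^4) \<Rightarrow> (real \<times> real \<Rightarrow> real^4) \<Rightarrow> (real \<times> real \<Rightarrow> real^4) \<Rightarrow> (real \<times> real \<Rightarrow> real^4) \<Rightarrow>
   (real \<times> real \<Rightarrow> real) \<Rightarrow> (real \<times> real \<Rightarrow> real) \<Rightarrow> (real \<times> real \<Rightarrow> real) \<Rightarrow> bool" where
  "parallel_transport_frame U \<Psi> T P\<^sub>1 P\<^sub>2 P\<^sub>3 k\<^sub>1 k\<^sub>2 k\<^sub>3 \<longleftrightarrow>
     smooth_on U T \<and> smooth_on U P\<^sub>1 \<and> smooth_on U P\<^sub>2 \<and> smooth_on U P\<^sub>3 \<and>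
     (\<forall>p\<in>U.
        positive_orthonormal_frame (T p) (P\<^sub>1 p) (P\<^sub>2 p) (P\<^sub>3 p) \<and>
        T p = partial_s \<Psi> p \<and>
        partial_s T p = k\<^sub>1 p *\<^sub>R P\<^sub>1 p + k\<^sub>2 p *\<^sub>R P\<^sub>2 p + k\<^sub>3 p *\<^sub>R P\<^sub>3 p \<and>
        partial_s P\<^sub>1 p = - k\<^sub>1 p *\<^sub>R T p \<and>
        partial_s P\<^sub>2 p = - k\<^sub>2 p *\<^sub>R T p \<and>
        partial_s P\<^sub>3 p = - k\<^sub>3 p *\<^sub>R T p)"

definition tangent_plane :: "(real \<times> real \<Rightarrow> real^4) \<Rightarrow> real \<times> real \<Rightarrow> (real^4) set" where
  "tangent_plane \<Psi> p = span {partial_s \<Psi> p, partial_t \<Psi> p}"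

definition normal_plane :: "(real \<times> real \<Rightarrow> real^4) \<Rightarrow> real \<times> real \<Rightarrow> (real^4) set" where
  "normal_plane \<Psi> p = (tangent_plane \<Psi> p)\<^sup>\<bottom>"

definition tangential_part :: "(real \<times> real \<Rightarrow> real^4) \<Rightarrow> real \<times> real \<Rightarrow> real^4 \<Rightarrow> real^4" where
  "tangential_part \<Psi> p x = (THE y. y \<in> tangent_plane \<Psi> p \<and> x - y \<in> normal_plane \<Psi> p)"

(* Weingarten formula: A_N X is minus the tangential part of the derivative of the normal
   field N along the tangent vector X; X is pulled back to the parameter plane by the
   differential of \<Psi>, which is injective where \<Psi> is an immersion. *)
definition shape_operator ::
  "(real \<times> real \<Rightarrow> real^4) \<Rightarrow> (real \<times> real \<Rightarrow> real^4) \<Rightarrow> real \<times> real \<Rightarrow> real^4 \<Rightarrow> real^4" where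
  "shape_operator \<Psi> N p X =
     - tangential_part \<Psi> p
         (frechet_derivative N (at p) (inv (frechet_derivative \<Psi> (at p)) X))"

(* Matrix of an endomorphism f of the plane spanned by the basis b1, b2. *)
definition plane_matrix :: "real^4 \<Rightarrow> real^4 \<Rightarrow> (real^4 \<Rightarrow> real^4) \<Rightarrow> real^2^2" where
  "plane_matrix b1 b2 f = (THE M. f b1 = M$1$1 *\<^sub>R b1 + M$2$1 *\<^sub>R b2 \<and>
                                  f b2 = M$1$2 *\<^sub>R b1 + M$2$2 *\<^sub>R b2)"

definition det_shape_operator ::
  "(real \<times> real \<Rightarrow> real^4) \<Rightarrow> (real \<times> real \<Rightarrow> real^4) \<Rightarrow> real \<times> real \<Rightarrow> real" where
  "det_shape_operator \<Psi> N p =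
     det (plane_matrix (partial_s \<Psi> p) (partial_t \<Psi> p) (shape_operator \<Psi> N p))"

definition orthonormal_normal_frame ::
  "(real \<times> real) set \<Rightarrow> (real \<times> real \<Rightarrow> real^4) \<Rightarrow>
   (real \<times> real \<Rightarrow> real^4) \<Rightarrow> (real \<times> real \<Rightarrow> real^4) \<Rightarrow> bool" where
  "orthonormal_normal_frame V \<Psi> N\<^sub>1 N\<^sub>2 \<longleftrightarrow>
     smooth_on V N\<^sub>1 \<and> smooth_on V N\<^sub>2 \<and>
     (\<forall>p\<in>V. N\<^sub>1 p \<in> normal_plane \<Psi> p \<and> N\<^sub>2 p \<in> normal_plane \<Psi> p \<and>
        norm (N\<^sub>1 p) = 1 \<and> norm (N\<^sub>2 p) = 1 \<and> N\<^sub>1 p \<bullet> N\<^sub>2 p = 0)"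

(* On an immersed surface orthonormal frames of the normal bundle exist near every point and
   the value does not depend on the choice of the frame, so the description is definite. *)
definition gaussian_curvature :: "(real \<times> real \<Rightarrow> real^4) \<Rightarrow> real \<times> real \<Rightarrow> real" where
  "gaussian_curvature \<Psi> p = (THE K. \<exists>V N\<^sub>1 N\<^sub>2. open V \<and> p \<in> V \<and>
     orthonormal_normal_frame V \<Psi> N\<^sub>1 N\<^sub>2 \<and>
     K = det_shape_operator \<Psi> N\<^sub>1 p + det_shape_operator \<Psi> N\<^sub>2 p)"

definition flat_surface :: "(real \<times> real) set \<Rightarrow> (real \<times> real \<Rightarrow> real^4) \<Rightarrow> bool" where
  "flat_surface U \<Psi> \<longleftrightarrow> (\<forall>p\<in>U. gaussian_curvature \<Psi> p = 0)"

definition P_fun :: "(real \<times> real \<Rightarrow> real) \<Rightarrow> (real \<times> real \<Rightarrow> real) \<Rightarrow> (real \<times> real \<Rightarrow> real) \<Rightarrow> real \<times> real \<Rightarrow> real" where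
  "P_fun k\<^sub>1 k\<^sub>2 k\<^sub>3 p = k\<^sub>3 p * partial_s k\<^sub>2 p - k\<^sub>2 p * partial_s k\<^sub>3 p"

definition R_fun :: "(real \<times> real \<Rightarrow> real) \<Rightarrow> (real \<times> real \<Rightarrow> real) \<Rightarrow> (real \<times> real \<Rightarrow> real) \<Rightarrow> real \<times> real \<Rightarrow> real" where
  "R_fun k\<^sub>1 k\<^sub>2 k\<^sub>3 p = k\<^sub>1 p * partial_s k\<^sub>3 p - k\<^sub>3 p * partial_s k\<^sub>1 p"

definition S_fun :: "(real \<times> real \<Rightarrow> real) \<Rightarrow> (real \<times> real \<Rightarrow> real) \<Rightarrow> (real \<times> real \<Rightarrow> real) \<Rightarrow> real \<times> real \<Rightarrow> real" where
  "S_fun k\<^sub>1 k\<^sub>2 k\<^sub>3 p = k\<^sub>2 p * partial_s k\<^sub>1 p - k\<^sub>1 p * partial_s k\<^sub>2 p"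

definition Q_fun :: "(real \<times> real \<Rightarrow> real) \<Rightarrow> (real \<times> real \<Rightarrow> real) \<Rightarrow> (real \<times> real \<Rightarrow> real) \<Rightarrow> real \<times> real \<Rightarrow> real" where
  "Q_fun k\<^sub>1 k\<^sub>2 k\<^sub>3 p = sqrt ((k\<^sub>1 p)\<^sup>2 + (k\<^sub>2 p)\<^sup>2 + (k\<^sub>3 p)\<^sup>2)"

definition W_fun :: "(real \<times> real \<Rightarrow> real) \<Rightarrow> (real \<times> real \<Rightarrow> real) \<Rightarrow> (real \<times> real \<Rightarrow> real) \<Rightarrow> real \<times> real \<Rightarrow> real" where
  "W_fun k\<^sub>1 k\<^sub>2 k\<^sub>3 p =
     sqrt ((P_fun k\<^sub>1 k\<^sub>2 k\<^sub>3 p)\<^sup>2 + (R_fun k\<^sub>1 k\<^sub>2 k\<^sub>3 p)\<^sup>2 + (S_fun k\<^sub>1 k\<^sub>2 k\<^sub>3 p)\<^sup>2)"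

definition A_fun ::
  "(real \<times> real \<Rightarrow> real^4) \<Rightarrow> (real \<times> real \<Rightarrow> real^4) \<Rightarrow> (real \<times> real \<Rightarrow> real^4) \<Rightarrow>
   (real \<times> real \<Rightarrow> real) \<Rightarrow> (real \<times> real \<Rightarrow> real) \<Rightarrow> (real \<times> real \<Rightarrow> real) \<Rightarrow> real \<times> real \<Rightarrow> real" where
  "A_fun P\<^sub>1 P\<^sub>2 P\<^sub>3 k\<^sub>1 k\<^sub>2 k\<^sub>3 p =
     (let P = P_fun k\<^sub>1 k\<^sub>2 k\<^sub>3 p; R = R_fun k\<^sub>1 k\<^sub>2 k\<^sub>3 p; S = S_fun k\<^sub>1 k\<^sub>2 k\<^sub>3 p;
          a\<^sub>2\<^sub>3 = partial_t P\<^sub>1 p \<bullet> P\<^sub>2 p; a\<^sub>2\<^sub>4 = partial_t P\<^sub>1 p \<bullet> P\<^sub>3 p; a\<^sub>3\<^sub>4 = partial_t P\<^sub>2 p \<bullet> P\<^sub>3 p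
      in (P * k\<^sub>3 p - S * k\<^sub>1 p) * a\<^sub>2\<^sub>4 + (P * k\<^sub>2 p - R * k\<^sub>1 p) * a\<^sub>2\<^sub>3 + (R * k\<^sub>3 p - S * k\<^sub>2 p) * a\<^sub>3\<^sub>4
         - R * partial_t k\<^sub>2 p - S * partial_t k\<^sub>3 p - P * partial_t k\<^sub>1 p)"

definition C_fun :: "(real \<times> real \<Rightarrow> real) \<Rightarrow> (real \<times> real \<Rightarrow> real) \<Rightarrow> (real \<times> real \<Rightarrow> real) \<Rightarrow> real \<times> real \<Rightarrow> real" where
  "C_fun k\<^sub>1 k\<^sub>2 k\<^sub>3 p =
     partial_s k\<^sub>1 p * partial_s (P_fun k\<^sub>1 k\<^sub>2 k\<^sub>3) p +
     partial_s k\<^sub>2 p * partial_s (R_fun k\<^sub>1 k\<^sub>2 k\<^sub>3) p +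
     partial_s k\<^sub>3 p * partial_s (S_fun k\<^sub>1 k\<^sub>2 k\<^sub>3) p"

(* Non-zero as a function on U: it may still vanish at some points. *)
definition nonzero_on :: "'a set \<Rightarrow> ('a \<Rightarrow> real) \<Rightarrow> bool" where
  "nonzero_on U k \<longleftrightarrow> (\<exists>p\<in>U. k p \<noteq> 0)"

end

theory Submission
  imports Defs
begin

text \<open>
  Write \<open>k = (k\<^sub>1, k\<^sub>2, k\<^sub>3)\<close> and \<open>w = (P, R, S)\<close>. In the parallel transport frame \<open>\<Psi>\<^sub>s\<^sub>s\<close> has normal
  coordinates \<open>k\<close>, and the soliton equation says that \<open>\<Psi>\<^sub>t\<close> has coordinates \<open>w = k\<^sub>s \<times> k\<close>. Hence the
  parametrisation is orthogonal, with \<open>\<bar>\<Psi>\<^sub>s\<bar> = 1\<close> and \<open>\<bar>\<Psi>\<^sub>t\<bar> = \<W>\<close>, and the Gauss equation reads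
  \<open>K \<W>\<^sup>2 = \<langle>\<Psi>\<^sub>s\<^sub>s\<^sup>\<bottom>, \<Psi>\<^sub>t\<^sub>t\<^sup>\<bottom>\<rangle> - \<bar>\<Psi>\<^sub>s\<^sub>t\<^sup>\<bottom>\<bar>\<^sup>2\<close>. The first term is \<open>\<A>\<close> since \<open>\<Psi>\<^sub>s\<^sub>s\<close> is already normal. As \<open>k \<bottom> w\<close>,
  \<open>\<Psi>\<^sub>s\<^sub>t\<close> has coordinates \<open>w\<^sub>s\<close>, which is orthogonal to \<open>k\<close>, so its normal part is its component along
  \<open>k \<times> w\<close>, of length \<open>Q \<bar>\<C>\<bar> / \<W>\<close>. Therefore \<open>K \<W>\<^sup>4 = \<A> \<W>\<^sup>2 - Q\<^sup>2 \<C>\<^sup>2\<close>.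
\<close>

subsection \<open>Smooth functions\<close>

lemma times_differentiable_on_has_derivative:
  "times_differentiable_on (Suc n) U f \<Longrightarrow> x \<in> U \<Longrightarrow>
    (f has_derivative frechet_derivative f (at x)) (at x)"
  by (simp flip: frechet_derivative_works)

text \<open>Derivatives depend only on values near a point, and openness of \<open>U\<close>
  supplies the neighbourhood. The Frechet derivatives then agree on \<open>U\<close> too, which is
  why the induction runs over arbitrary \<open>f\<close> and \<open>g\<close>.\<close>

lemma times_differentiable_on_cong:
  assumes "open U" "\<And>x. x \<in> U \<Longrightarrow> f x = g x" "times_differentiable_on n U f"
  shows "times_differentiable_on n U g"
  using assms(2,3)
proof (induction n arbitrary: f g)
  case 0
  then show ?case using continuous_on_cong[OF refl, of U f g] by simp
next
  case (Suc n)
  have D: "(g has_derivative frechet_derivative f (at x)) (at x)" if "x \<in> U" for x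
    using Suc.prems(1) that
    by (intro has_derivative_transform_within_open[OF times_differentiable_on_has_derivative[OF Suc.prems(2) that] assms(1)]) auto
  then have "frechet_derivative f (at x) = frechet_derivative g (at x)" if "x \<in> U" for x
    using that frechet_derivative_at by blast
  then have "times_differentiable_on n U (\<lambda>x. frechet_derivative g (at x) v)" for v
    using Suc.IH[of "\<lambda>x. frechet_derivative f (at x) v" "\<lambda>x. frechet_derivative g (at x) v"] Suc.prems(2)
    by simp
  moreover have "\<forall>x\<in>U. g differentiable (at x)"
    using D by (auto simp: differentiable_def)
  ultimately show ?case
    by simp
qed

lemma times_differentiable_on_Suc_imp:
  "times_differentiable_on (Suc n) U f \<Longrightarrow> times_differentiable_on n U f"
proof (induction n arbitrary: f)
  case 0
  then show ?case
    using differentiable_imp_continuous_within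
    by (auto intro!: continuous_at_imp_continuous_on)
next
  case (Suc n)
  then show ?case
    \<comment> \<open>Only these two instances are unfolded: the derivatives stay folded at order
      \<open>Suc n\<close> in the hypothesis and \<open>n\<close> in the goal, as the induction
      hypothesis requires.\<close>
    unfolding times_differentiable_on.simps(2)[of "Suc n"] times_differentiable_on.simps(2)[of n U f]
    by blast
qed

text \<open>Derivatives are unique, so any explicit formula \<open>f'\<close> can stand in for
  \<open>frechet_derivative\<close>. The closure properties below are proved by exhibiting such a
  formula.\<close>

lemma times_differentiable_onI:
  assumes "open U"
    and "\<And>x. x \<in> U \<Longrightarrow> (f has_derivative f' x) (at x)"
    and "\<And>v. times_differentiable_on n U (\<lambda>x. f' x v)"
  shows "times_differentiable_on (Suc n) U f"
proof -
  have "f' x = frechet_derivative f (at x)" if "x \<in> U" for x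
    using that assms(2) frechet_derivative_at by blast
  then have "times_differentiable_on n U (\<lambda>x. frechet_derivative f (at x) v)" for v
    by (intro times_differentiable_on_cong[OF assms(1) _ assms(3)[of v]]) simp
  moreover have "\<forall>x\<in>U. f differentiable (at x)"
    using assms(2) by (auto simp: differentiable_def)
  ultimately show ?thesis
    by simp
qed

lemma times_differentiable_on_frechet_derivative:
  "times_differentiable_on (Suc n) U f \<Longrightarrow> times_differentiable_on n U (\<lambda>x. frechet_derivative f (at x) v)"
  by simp

section \<open>Closure under sums, products, inverses and square roots\<close>

lemma times_differentiable_on_const:
  assumes "open U"
  shows "times_differentiable_on n U (\<lambda>x. c)"
proof (induction n arbitrary: c)
  case (Suc n)
  show ?case
    by (rule times_differentiable_onI[OF assms has_derivative_const Suc])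
qed simp

lemma times_differentiable_on_add:
  assumes "open U" "times_differentiable_on n U f" "times_differentiable_on n U g"
  shows "times_differentiable_on n U (\<lambda>x. f x + g x)"
  using assms(2,3)
proof (induction n arbitrary: f g)
  case 0
  then show ?case by (auto intro: continuous_on_add)
next
  case (Suc n)
  show ?case
  proof (rule times_differentiable_onI[OF assms(1)])
    show "((\<lambda>x. f x + g x) has_derivative
        (\<lambda>v. frechet_derivative f (at x) v + frechet_derivative g (at x) v)) (at x)" if "x \<in> U" for x
      using Suc.prems that by (intro has_derivative_add times_differentiable_on_has_derivative)
  qed (use Suc in simp)
qed

text \<open>By the product rule the derivative is a sum of two terms of the same bilinear form with
  one factor differentiated, so induction over both factors closes. Multiplication, scaling and
  inner products are all instances.\<close>

lemma times_differentiable_on_bilinear: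
  assumes "bounded_bilinear b" "open U" "times_differentiable_on n U f" "times_differentiable_on n U g"
  shows "times_differentiable_on n U (\<lambda>x. b (f x) (g x))"
  using assms(3,4)
proof (induction n arbitrary: f g)
  case 0
  then show ?case by (auto intro: bounded_bilinear.continuous_on[OF assms(1)])
next
  case (Suc n)
  show ?case
  proof (rule times_differentiable_onI[OF assms(2)])
    show "((\<lambda>x. b (f x) (g x)) has_derivative
        (\<lambda>v. b (f x) (frechet_derivative g (at x) v) + b (frechet_derivative f (at x) v) (g x))) (at x)"
      if "x \<in> U" for x
      using Suc.prems that
      by (intro bounded_bilinear.FDERIV[OF assms(1)] times_differentiable_on_has_derivative)
    show "times_differentiable_on n U (\<lambda>x. b (f x) (frechet_derivative g (at x) v) +
        b (frechet_derivative f (at x) v) (g x))" for v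
      by (intro times_differentiable_on_add[OF assms(2)] Suc.IH Suc.prems[THEN times_differentiable_on_Suc_imp]
          Suc.prems[THEN times_differentiable_on_frechet_derivative])
  qed
qed

text \<open>The derivative is a polynomial in \<open>inverse (f x)\<close> and the derivative of
  \<open>f\<close>, so each order of differentiability of the inverse yields the next.\<close>

lemma times_differentiable_on_inverse:
  fixes f :: "'a::real_normed_vector \<Rightarrow> real"
  assumes "open U" "\<And>x. x \<in> U \<Longrightarrow> f x \<noteq> 0" "times_differentiable_on n U f"
  shows "times_differentiable_on n U (\<lambda>x. inverse (f x))"
  using assms(3)
proof (induction n)
  case 0
  then show ?case using assms(2) by (simp add: continuous_on_inverse)
next
  case (Suc n)
  note I = Suc.IH[OF times_differentiable_on_Suc_imp[OF Suc.prems]]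
  show ?case
  proof (rule times_differentiable_onI[OF assms(1)])
    show "((\<lambda>x. inverse (f x)) has_derivative
        (\<lambda>v. (- 1) * (inverse (f x) * (frechet_derivative f (at x) v * inverse (f x))))) (at x)"
      if "x \<in> U" for x
      using Deriv.has_derivative_inverse[OF assms(2)[OF that]
          times_differentiable_on_has_derivative[OF Suc.prems that]]
      by (simp add: mult.assoc)
    show "times_differentiable_on n U (\<lambda>x. (- 1) * (inverse (f x) *
        (frechet_derivative f (at x) v * inverse (f x))))" for v
      by (intro times_differentiable_on_bilinear[OF bounded_bilinear_mult assms(1)] I
          times_differentiable_on_const[OF assms(1)] times_differentiable_on_frechet_derivative[OF Suc.prems])
  qed
qed

text \<open>The same bootstrapping: the derivative involves only the derivative of \<open>f\<close>
  and the inverse of the square root itself.\<close>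

lemma times_differentiable_on_sqrt:
  fixes f :: "'a::real_normed_vector \<Rightarrow> real"
  assumes "open U" "\<And>x. x \<in> U \<Longrightarrow> f x > 0" "times_differentiable_on n U f"
  shows "times_differentiable_on n U (\<lambda>x. sqrt (f x))"
  using assms(3)
proof (induction n)
  case 0
  then show ?case by (simp add: continuous_on_real_sqrt)
next
  case (Suc n)
  note I = Suc.IH[OF times_differentiable_on_Suc_imp[OF Suc.prems]]
  show ?case
  proof (rule times_differentiable_onI[OF assms(1)])
    show "((\<lambda>x. sqrt (f x)) has_derivative
        (\<lambda>v. frechet_derivative f (at x) v * (inverse (sqrt (f x)) * (1 / 2)))) (at x)"
      if "x \<in> U" for x
      using has_derivative_real_sqrt[OF assms(2)[OF that]
          times_differentiable_on_has_derivative[OF Suc.prems that]]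
      by (simp add: field_simps)
    have "times_differentiable_on n U (\<lambda>x. inverse (sqrt (f x)))"
      using assms(2) by (intro times_differentiable_on_inverse[OF assms(1)] I) force
    then show "times_differentiable_on n U
        (\<lambda>x. frechet_derivative f (at x) v * (inverse (sqrt (f x)) * (1 / 2)))" for v
      by (intro times_differentiable_on_bilinear[OF bounded_bilinear_mult assms(1)]
          times_differentiable_on_frechet_derivative[OF Suc.prems]
          times_differentiable_on_const[OF assms(1)])
  qed
qed

section \<open>The same closure properties for all orders at once\<close>

lemma smooth_on_cong:
  "open U \<Longrightarrow> (\<And>x. x \<in> U \<Longrightarrow> f x = g x) \<Longrightarrow> smooth_on U f \<Longrightarrow> smooth_on U g"
  unfolding smooth_on_def by (intro allI times_differentiable_on_cong[of U f g]) simp_all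

lemma smooth_on_const: "open U \<Longrightarrow> smooth_on U (\<lambda>x. c)"
  by (simp add: smooth_on_def times_differentiable_on_const)

lemma smooth_on_add:
  "open U \<Longrightarrow> smooth_on U f \<Longrightarrow> smooth_on U g \<Longrightarrow> smooth_on U (\<lambda>x. f x + g x)"
  by (simp add: smooth_on_def times_differentiable_on_add)

lemma smooth_on_bilinear:
  "bounded_bilinear b \<Longrightarrow> open U \<Longrightarrow> smooth_on U f \<Longrightarrow> smooth_on U g \<Longrightarrow>
    smooth_on U (\<lambda>x. b (f x) (g x))"
  by (simp add: smooth_on_def times_differentiable_on_bilinear)

lemmas smooth_on_scaleR = smooth_on_bilinear[OF bounded_bilinear_scaleR]
lemmas smooth_on_inner = smooth_on_bilinear[OF bounded_bilinear_inner]

lemma smooth_on_mult: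
  fixes f g :: "'a::real_normed_vector \<Rightarrow> real"
  shows "open U \<Longrightarrow> smooth_on U f \<Longrightarrow> smooth_on U g \<Longrightarrow> smooth_on U (\<lambda>x. f x * g x)"
  by (rule smooth_on_bilinear[OF bounded_bilinear_mult])

lemma smooth_on_diff:
  assumes "open U" "smooth_on U f" "smooth_on U g"
  shows "smooth_on U (\<lambda>x. f x - g x)"
  using smooth_on_add[OF assms(1,2) smooth_on_scaleR[OF assms(1) smooth_on_const[OF assms(1), of "- 1"] assms(3)]]
  by simp

lemma smooth_on_inverse:
  fixes f :: "'a::real_normed_vector \<Rightarrow> real"
  shows "open U \<Longrightarrow> (\<And>x. x \<in> U \<Longrightarrow> f x \<noteq> 0) \<Longrightarrow> smooth_on U f \<Longrightarrow> smooth_on U (\<lambda>x. inverse (f x))"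
  by (simp add: smooth_on_def times_differentiable_on_inverse)

lemma smooth_on_sqrt:
  fixes f :: "'a::real_normed_vector \<Rightarrow> real"
  shows "open U \<Longrightarrow> (\<And>x. x \<in> U \<Longrightarrow> f x > 0) \<Longrightarrow> smooth_on U f \<Longrightarrow> smooth_on U (\<lambda>x. sqrt (f x))"
  by (simp add: smooth_on_def times_differentiable_on_sqrt)

lemma smooth_on_has_derivative:
  "smooth_on U f \<Longrightarrow> x \<in> U \<Longrightarrow> (f has_derivative frechet_derivative f (at x)) (at x)"
  unfolding smooth_on_def by (rule times_differentiable_on_has_derivative[of 0]) simp_all

lemma smooth_on_frechet_derivative:
  "smooth_on U f \<Longrightarrow> smooth_on U (\<lambda>x. frechet_derivative f (at x) v)"
  unfolding smooth_on_def by (intro allI times_differentiable_on_frechet_derivative) simp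

lemma smooth_on_imp_continuous_on: "smooth_on U f \<Longrightarrow> continuous_on U f"
  unfolding smooth_on_def using times_differentiable_on.simps(1)[of U f] by metis

subsection \<open>Partial derivatives\<close>

text \<open>Chain rule for the embeddings of the two coordinate lines through \<open>p\<close>; it
  links \<open>partial_s\<close> and \<open>partial_t\<close>, defined by one-variable derivatives,
  to the total derivative.\<close>

lemma has_derivative_along_coordinate:
  assumes "(f has_derivative f') (at p)"
  shows "((\<lambda>s. f (s, snd p)) has_vector_derivative f' (1, 0)) (at (fst p))"
    and "((\<lambda>t. f (fst p, t)) has_vector_derivative f' (0, 1)) (at (snd p))"
proof -
  have lin: "linear f'"
    using assms has_derivative_linear by blast
  have "((\<lambda>s. (s, snd p)) has_derivative (\<lambda>h. (h, 0))) (at (fst p))"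
    "((\<lambda>t. (fst p, t)) has_derivative (\<lambda>h. (0, h))) (at (snd p))"
    by (auto intro!: derivative_eq_intros)
  from this[THEN diff_chain_at, of f f'] assms
  have "((\<lambda>s. f (s, snd p)) has_derivative (\<lambda>h. f' (h, 0))) (at (fst p))"
    "((\<lambda>t. f (fst p, t)) has_derivative (\<lambda>h. f' (0, h))) (at (snd p))"
    by (simp_all add: o_def)
  moreover have "(\<lambda>h. f' (h, 0)) = (\<lambda>h. h *\<^sub>R f' (1, 0))" "(\<lambda>h. f' (0, h)) = (\<lambda>h. h *\<^sub>R f' (0, 1))"
    by (auto simp: fun_eq_iff simp flip: linear_scale[OF lin])
  ultimately show "((\<lambda>s. f (s, snd p)) has_vector_derivative f' (1, 0)) (at (fst p))"
    and "((\<lambda>t. f (fst p, t)) has_vector_derivative f' (0, 1)) (at (snd p))"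
    unfolding has_vector_derivative_def by metis+
qed

lemma partial_eqI:
  assumes "(f has_derivative f') (at p)"
  shows "partial_s f p = f' (1, 0)" and "partial_t f p = f' (0, 1)"
  using has_derivative_along_coordinate[OF assms]
  by (simp_all add: partial_s_def partial_t_def vector_derivative_at)

lemma partial_cong:
  assumes "open U" "p \<in> U" "\<And>x. x \<in> U \<Longrightarrow> f x = g x" "f differentiable (at p)"
  shows "partial_s g p = partial_s f p" and "partial_t g p = partial_t f p"
    and "g differentiable (at p)"
proof -
  obtain f' where f': "(f has_derivative f') (at p)"
    using assms(4) differentiable_def by blast
  then have g': "(g has_derivative f') (at p)"
    using assms by (intro has_derivative_transform_within_open[OF f' assms(1)]) auto
  show "partial_s g p = partial_s f p" "partial_t g p = partial_t f p" "g differentiable (at p)"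
    using partial_eqI[OF f'] partial_eqI[OF g'] g' by (auto simp: differentiable_def)
qed

lemma partial_add:
  assumes "f differentiable (at p)" "g differentiable (at p)"
  shows "partial_s (\<lambda>x. f x + g x) p = partial_s f p + partial_s g p"
    and "partial_t (\<lambda>x. f x + g x) p = partial_t f p + partial_t g p"
proof -
  obtain f' g' where "(f has_derivative f') (at p)" "(g has_derivative g') (at p)"
    using assms unfolding differentiable_def by blast
  then show "partial_s (\<lambda>x. f x + g x) p = partial_s f p + partial_s g p"
    "partial_t (\<lambda>x. f x + g x) p = partial_t f p + partial_t g p"
    using partial_eqI[OF has_derivative_add[of f f' "at p" g g']] partial_eqI[of f f' p] partial_eqI[of g g' p]
    by auto
qed

lemma partial_diff:
  assumes "f differentiable (at p)" "g differentiable (at p)"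
  shows "partial_s (\<lambda>x. f x - g x) p = partial_s f p - partial_s g p"
    and "partial_t (\<lambda>x. f x - g x) p = partial_t f p - partial_t g p"
proof -
  obtain f' g' where "(f has_derivative f') (at p)" "(g has_derivative g') (at p)"
    using assms unfolding differentiable_def by blast
  then show "partial_s (\<lambda>x. f x - g x) p = partial_s f p - partial_s g p"
    "partial_t (\<lambda>x. f x - g x) p = partial_t f p - partial_t g p"
    using partial_eqI[OF has_derivative_diff[of f f' "at p" g g']] partial_eqI[of f f' p] partial_eqI[of g g' p]
    by auto
qed

lemma partial_bilinear:
  assumes "bounded_bilinear b" "f differentiable (at p)" "g differentiable (at p)"
  shows "partial_s (\<lambda>x. b (f x) (g x)) p = b (f p) (partial_s g p) + b (partial_s f p) (g p)"
    and "partial_t (\<lambda>x. b (f x) (g x)) p = b (f p) (partial_t g p) + b (partial_t f p) (g p)"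
    and "(\<lambda>x. b (f x) (g x)) differentiable (at p)"
proof -
  obtain f' g' where fg: "(f has_derivative f') (at p)" "(g has_derivative g') (at p)"
    using assms(2,3) unfolding differentiable_def by blast
  note D = bounded_bilinear.FDERIV[OF assms(1) fg]
  show "partial_s (\<lambda>x. b (f x) (g x)) p = b (f p) (partial_s g p) + b (partial_s f p) (g p)"
    "partial_t (\<lambda>x. b (f x) (g x)) p = b (f p) (partial_t g p) + b (partial_t f p) (g p)"
    "(\<lambda>x. b (f x) (g x)) differentiable (at p)"
    using partial_eqI[OF D] fg[THEN partial_eqI(1)] fg[THEN partial_eqI(2)] D by (auto simp: differentiable_def)
qed

lemmas partial_scaleR = partial_bilinear[OF bounded_bilinear_scaleR]
lemmas partial_mult = partial_bilinear[OF bounded_bilinear_mult]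
lemmas partial_inner = partial_bilinear[OF bounded_bilinear_inner]

lemma smooth_on_differentiable: "smooth_on U f \<Longrightarrow> p \<in> U \<Longrightarrow> f differentiable (at p)"
  unfolding differentiable_def by (rule exI, rule smooth_on_has_derivative)

lemma smooth_on_partial:
  assumes "open U" "smooth_on U f"
  shows "smooth_on U (partial_s f)" and "smooth_on U (partial_t f)"
proof -
  have "partial_s f p = frechet_derivative f (at p) (1, 0)"
    "partial_t f p = frechet_derivative f (at p) (0, 1)" if "p \<in> U" for p
    using partial_eqI[OF smooth_on_has_derivative[OF assms(2) that]] by auto
  then show "smooth_on U (partial_s f)" "smooth_on U (partial_t f)"
    by (auto intro!: smooth_on_cong[OF assms(1) _ smooth_on_frechet_derivative[OF assms(2)]])
qed

section \<open>Symmetry of mixed second partial derivatives\<close>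

lemma second_difference_mean_value:
  fixes g gx gxy :: "real \<Rightarrow> real \<Rightarrow> real"
  assumes "h > 0"
    and gx: "\<And>x y. x \<in> {a..a + h} \<Longrightarrow> y \<in> {b..b + h} \<Longrightarrow>
        ((\<lambda>x. g x y) has_real_derivative gx x y) (at x)"
    and gxy: "\<And>x y. x \<in> {a..a + h} \<Longrightarrow> y \<in> {b..b + h} \<Longrightarrow>
        ((\<lambda>y. gx x y) has_real_derivative gxy x y) (at y)"
  shows "\<exists>x\<in>{a..a + h}. \<exists>y\<in>{b..b + h}.
    g (a + h) (b + h) - g (a + h) b - g a (b + h) + g a b = h\<^sup>2 * gxy x y"
proof -
  \<comment> \<open>The mean value theorem is applied first in \<open>x\<close> to the difference of
    the two horizontal slices, then in \<open>y\<close> to \<open>gx x\<close>.\<close>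
  have "\<exists>x. a < x \<and> x < a + h \<and>
      (g (a + h) (b + h) - g (a + h) b) - (g a (b + h) - g a b) = (a + h - a) * (gx x (b + h) - gx x b)"
    using assms(1)
    by (intro MVT2[of a "a + h" "\<lambda>x. g x (b + h) - g x b"]) (auto intro!: DERIV_diff gx)
  then obtain x where x: "a < x" "x < a + h"
    "(g (a + h) (b + h) - g (a + h) b) - (g a (b + h) - g a b) = h * (gx x (b + h) - gx x b)"
    by auto
  have "\<exists>y. b < y \<and> y < b + h \<and> gx x (b + h) - gx x b = (b + h - b) * gxy x y"
    using assms(1) x by (intro MVT2[of b "b + h" "gx x"] gxy) auto
  then obtain y where "b < y" "y < b + h" "gx x (b + h) - gx x b = h * gxy x y"
    by auto
  with x show ?thesis
    by (intro bexI[of _ x] bexI[of _ y]) (auto simp: power2_eq_square)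
qed

text \<open>The second difference of \<open>f\<close> over a small square at \<open>p\<close> equals
  \<open>h\<^sup>2\<close> times either mixed derivative, each at some point of the square. By
  continuity, two different values at \<open>p\<close> would contradict this.\<close>

lemma partial_commute_real:
  fixes f :: "real \<times> real \<Rightarrow> real"
  assumes "open U" "smooth_on U f" "p \<in> U"
  shows "partial_s (partial_t f) p = partial_t (partial_s f) p"
proof (rule ccontr)
  let ?A = "partial_s (partial_t f)" and ?B = "partial_t (partial_s f)"
  assume "?A p \<noteq> ?B p"
  \<comment> \<open>Half the supposed gap: two values equal to each other cannot lie within
    \<open>e\<close> of both \<open>?A p\<close> and \<open>?B p\<close>.\<close>
  define e where "e = dist (?A p) (?B p) / 2"
  have e: "e > 0" using \<open>?A p \<noteq> ?B p\<close> by (simp add: e_def)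
  note sm = smooth_on_partial[OF assms(1)]
  have "isCont ?A p" "isCont ?B p"
    using sm(1)[OF sm(2)[OF assms(2)]] sm(2)[OF sm(1)[OF assms(2)]] assms(1,3)
      smooth_on_imp_continuous_on continuous_on_eq_continuous_at by blast+
  then have "\<forall>\<^sub>F q in nhds p. q \<in> U \<and> dist (?A q) (?A p) < e \<and> dist (?B q) (?B p) < e"
    using e assms(1,3) unfolding isCont_def
    by (intro eventually_conj eventually_nhds_in_open) (auto simp: tendsto_iff eventually_nhds_conv_at)
  then obtain d where d: "d > 0"
    "\<And>q. dist q p < d \<Longrightarrow> q \<in> U \<and> dist (?A q) (?A p) < e \<and> dist (?B q) (?B p) < e"
    unfolding eventually_nhds_metric by blast
  obtain a b where p: "p = (a, b)" by (cases p)
  \<comment> \<open>Every point of the square of side \<open>h\<close> is at distance at most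
    \<open>2 * h < d\<close> from \<open>p\<close>.\<close>
  define h where "h = d / 3"
  have h: "h > 0" using d by (simp add: h_def)
  have near: "dist (x, y) p < d" if "x \<in> {a..a + h}" "y \<in> {b..b + h}" for x y
  proof -
    have "dist (x, y) p \<le> dist x a + dist y b"
      unfolding p dist_Pair_Pair by (rule sqrt_sum_squares_le_sum) auto
    also have "\<dots> \<le> h + h" using that by (auto simp: dist_real_def)
    finally show ?thesis using d(1) by (simp add: h_def)
  qed
  have part: "((\<lambda>x. g (x, y)) has_real_derivative partial_s g (x, y)) (at x)"
    "((\<lambda>y. g (x, y)) has_real_derivative partial_t g (x, y)) (at y)"
    if "smooth_on U g" "x \<in> {a..a + h}" "y \<in> {b..b + h}" for g x y
    using has_derivative_along_coordinate[OF smooth_on_has_derivative[OF that(1)], of "(x, y)"]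
      partial_eqI[OF smooth_on_has_derivative[OF that(1)], of "(x, y)"] d(2)[OF near[OF that(2,3)]]
    by (auto simp: has_real_derivative_iff_has_vector_derivative)
  obtain x y where xy: "x \<in> {a..a + h}" "y \<in> {b..b + h}"
    "f (a + h, b + h) - f (a + h, b) - f (a, b + h) + f (a, b) = h\<^sup>2 * ?B (x, y)"
    using second_difference_mean_value[of h a b "\<lambda>x y. f (x, y)" "\<lambda>x y. partial_s f (x, y)" "\<lambda>x y. ?B (x, y)"]
      part(1)[OF assms(2)] part(2)[OF sm(1)[OF assms(2)]] h by blast
  \<comment> \<open>The same second difference, with the roles of the two coordinates
    exchanged.\<close>
  obtain x' y' where xy': "x' \<in> {a..a + h}" "y' \<in> {b..b + h}"
    "f (a + h, b + h) - f (a, b + h) - f (a + h, b) + f (a, b) = h\<^sup>2 * ?A (x', y')"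
    using second_difference_mean_value[of h b a "\<lambda>y x. f (x, y)" "\<lambda>y x. partial_t f (x, y)" "\<lambda>y x. ?A (x, y)"]
      part(2)[OF assms(2)] part(1)[OF sm(2)[OF assms(2)]] h by blast
  have "h\<^sup>2 * ?A (x', y') = h\<^sup>2 * ?B (x, y)"
    using xy(3) xy'(3) by linarith
  then have "?A (x', y') = ?B (x, y)"
    using h by simp
  then show False
    using d(2)[OF near[OF xy(1,2)]] d(2)[OF near[OF xy'(1,2)]] dist_triangle_half_r[of "?A (x', y')" "?A p" "2 * e" "?B p"]
    by (auto simp: e_def dist_commute)
qed

text \<open>Reduction to the real case by taking the inner product with each basis vector
  \<open>v\<close>, which commutes with both partial derivatives.\<close>

lemma partial_commute:
  fixes f :: "real \<times> real \<Rightarrow> 'a::euclidean_space"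
  assumes "open U" "smooth_on U f" "p \<in> U"
  shows "partial_s (partial_t f) p = partial_t (partial_s f) p"
proof (rule euclidean_eqI)
  fix v :: 'a
  note sm = smooth_on_partial[OF assms(1)]
  have const: "partial_s (\<lambda>x. v) q = 0" "partial_t (\<lambda>x. v) q = 0" for q
    using partial_eqI[OF has_derivative_const[of v]] by auto
  have D: "partial_s (\<lambda>x. g x \<bullet> v) q = partial_s g q \<bullet> v" "partial_t (\<lambda>x. g x \<bullet> v) q = partial_t g q \<bullet> v"
    if "smooth_on U g" "q \<in> U" for g q
    using partial_inner[OF smooth_on_differentiable[OF that] differentiable_const[of v]] const by auto
  have S: "smooth_on U (\<lambda>x. g x \<bullet> v)" if "smooth_on U g" for g
    using that by (intro smooth_on_inner assms smooth_on_const)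
  have "partial_s (partial_t f) p \<bullet> v = partial_s (\<lambda>x. partial_t f x \<bullet> v) p"
    by (rule D(1)[OF sm(2)[OF assms(2)] assms(3), symmetric])
  also have "\<dots> = partial_s (partial_t (\<lambda>x. f x \<bullet> v)) p"
    using D(2)[OF assms(2)] S[OF assms(2)] assms(3)
    by (intro partial_cong(1)[OF assms(1,3)] smooth_on_differentiable[OF sm(2)]) auto
  also have "\<dots> = partial_t (partial_s (\<lambda>x. f x \<bullet> v)) p"
    by (rule partial_commute_real[OF assms(1) S[OF assms(2)] assms(3)])
  also have "\<dots> = partial_t (\<lambda>x. partial_s f x \<bullet> v) p"
    using D(1)[OF assms(2)] assms(3)
    by (intro partial_cong(2)[OF assms(1,3)] smooth_on_differentiable[OF S[OF sm(1)[OF assms(2)]]]) auto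
  also have "\<dots> = partial_t (partial_s f) p \<bullet> v"
    by (rule D(2)[OF sm(1)[OF assms(2)] assms(3)])
  finally show "partial_s (partial_t f) p \<bullet> v = partial_t (partial_s f) p \<bullet> v" .
qed

subsection \<open>Orthonormal frames of four-space\<close>

lemma vector_4:
  "(vector [x, y, z, w] :: 'a::zero^4) $ 1 = x"
  "(vector [x, y, z, w] :: 'a::zero^4) $ 2 = y"
  "(vector [x, y, z, w] :: 'a::zero^4) $ 3 = z"
  "(vector [x, y, z, w] :: 'a::zero^4) $ 4 = w"
  by (simp_all add: vector_def)

lemma det_4:
  "det (A :: 'a::comm_ring_1^4^4) =
     A$1$1 * A$2$2 * A$3$3 * A$4$4 - A$1$1 * A$2$2 * A$3$4 * A$4$3
   - A$1$1 * A$2$3 * A$3$2 * A$4$4 + A$1$1 * A$2$3 * A$3$4 * A$4$2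
   + A$1$1 * A$2$4 * A$3$2 * A$4$3 - A$1$1 * A$2$4 * A$3$3 * A$4$2
   - A$1$2 * A$2$1 * A$3$3 * A$4$4 + A$1$2 * A$2$1 * A$3$4 * A$4$3
   + A$1$2 * A$2$3 * A$3$1 * A$4$4 - A$1$2 * A$2$3 * A$3$4 * A$4$1
   - A$1$2 * A$2$4 * A$3$1 * A$4$3 + A$1$2 * A$2$4 * A$3$3 * A$4$1
   + A$1$3 * A$2$1 * A$3$2 * A$4$4 - A$1$3 * A$2$1 * A$3$4 * A$4$2
   - A$1$3 * A$2$2 * A$3$1 * A$4$4 + A$1$3 * A$2$2 * A$3$4 * A$4$1
   + A$1$3 * A$2$4 * A$3$1 * A$4$2 - A$1$3 * A$2$4 * A$3$2 * A$4$1
   - A$1$4 * A$2$1 * A$3$2 * A$4$3 + A$1$4 * A$2$1 * A$3$3 * A$4$2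
   + A$1$4 * A$2$2 * A$3$1 * A$4$3 - A$1$4 * A$2$2 * A$3$3 * A$4$1
   - A$1$4 * A$2$3 * A$3$1 * A$4$2 + A$1$4 * A$2$3 * A$3$2 * A$4$1"
proof -
  \<comment> \<open>The permutations of the four indices are enumerated by splitting off one index
    at a time: each is a transposition composed with a permutation of the remaining indices.\<close>
  have f: "finite {2::4, 3, 4}" "1 \<notin> {2::4, 3, 4}" "finite {3::4, 4}" "2 \<notin> {3::4, 4}"
    "finite {4::4}" "3 \<notin> {4::4}"
    by auto
  show ?thesis
    unfolding det_def UNIV_4
    unfolding sum_over_permutations_insert[OF f(1,2)]
    unfolding sum_over_permutations_insert[OF f(3,4)]
    unfolding sum_over_permutations_insert[OF f(5,6)]
    unfolding permutes_sing
    by (simp add: sign_swap_id permutation_swap_id sign_compose permutation_compose sign_id swap_id_eq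
        algebra_simps)
qed

text \<open>Linearity of the determinant in its first row. This determines the product by its inner
  products with test vectors.\<close>

lemma inner_ternary_product: "v \<bullet> ternary_product x y z = det (vector [v, x, y, z] :: real^4^4)"
  unfolding ternary_product_def inner_vec_def sum_4 det_4
  by (simp add: vector_4 axis_def algebra_simps)

text \<open>The matrix with the frame as rows is orthogonal, hence preserves inner products, and it
  sends a vector to its coordinates in the frame.\<close>

lemma orthonormal_inner_expand:
  fixes a b c d x y :: "real^4"
  assumes "norm a = 1" "norm b = 1" "norm c = 1" "norm d = 1"
    "a \<bullet> b = 0" "a \<bullet> c = 0" "a \<bullet> d = 0" "b \<bullet> c = 0" "b \<bullet> d = 0" "c \<bullet> d = 0"
  shows "x \<bullet> y = (x \<bullet> a) * (y \<bullet> a) + (x \<bullet> b) * (y \<bullet> b) + (x \<bullet> c) * (y \<bullet> c) + (x \<bullet> d) * (y \<bullet> d)"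
    and "orthogonal_matrix (vector [a, b, c, d] :: real^4^4)"
proof -
  let ?F = "vector [a, b, c, d] :: real^4^4"
  have rows: "row 1 ?F = a" "row 2 ?F = b" "row 3 ?F = c" "row 4 ?F = d"
    by (simp_all add: row_def vector_4 vec_lambda_eta)
  show F: "orthogonal_matrix ?F"
    unfolding orthogonal_matrix_orthonormal_rows orthogonal_def forall_4
    using assms by (simp add: rows inner_commute)
  have comp: "(?F *v v) $ 1 = v \<bullet> a" "(?F *v v) $ 2 = v \<bullet> b" "(?F *v v) $ 3 = v \<bullet> c" "(?F *v v) $ 4 = v \<bullet> d"
    for v
    by (simp_all add: matrix_vector_mult_def vector_4 inner_vec_def mult.commute)
  have "x \<bullet> y = (?F *v x) \<bullet> (?F *v y)"
    using F orthogonal_transformation_matrix[of "(*v) ?F"]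
    by (simp add: orthogonal_transformation_def)
  then show "x \<bullet> y = (x \<bullet> a) * (y \<bullet> a) + (x \<bullet> b) * (y \<bullet> b) + (x \<bullet> c) * (y \<bullet> c) + (x \<bullet> d) * (y \<bullet> d)"
    by (simp add: inner_vec_def[of "?F *v x"] sum_4 comp)
qed

text \<open>In a positive orthonormal frame the product is computed as in the standard basis. With
  \<open>a\<close> as first factor it is a cross product of the remaining coordinates, and the
  component \<open>m0\<close> along \<open>a\<close> drops out.\<close>

lemma ternary_product_in_frame:
  assumes "positive_orthonormal_frame a b c d"
  shows "ternary_product a (k1 *\<^sub>R b + k2 *\<^sub>R c + k3 *\<^sub>R d) (m0 *\<^sub>R a + m1 *\<^sub>R b + m2 *\<^sub>R c + m3 *\<^sub>R d)
    = (k3 * m2 - k2 * m3) *\<^sub>R b + (k1 * m3 - k3 * m1) *\<^sub>R c + (k2 * m1 - k1 * m2) *\<^sub>R d"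
    (is "?l = ?r")
proof -
  note fr = assms[unfolded positive_orthonormal_frame_def]
  have one: "a \<bullet> a = 1" "b \<bullet> b = 1" "c \<bullet> c = 1" "d \<bullet> d = 1"
    using fr by (simp_all add: norm_eq_1)
  have zero: "a \<bullet> b = 0" "a \<bullet> c = 0" "a \<bullet> d = 0" "b \<bullet> c = 0" "b \<bullet> d = 0" "c \<bullet> d = 0"
    "b \<bullet> a = 0" "c \<bullet> a = 0" "d \<bullet> a = 0" "c \<bullet> b = 0" "d \<bullet> b = 0" "d \<bullet> c = 0"
    using fr by (simp_all add: inner_commute)
  have expand: "x \<bullet> y = (x \<bullet> a) * (y \<bullet> a) + (x \<bullet> b) * (y \<bullet> b) + (x \<bullet> c) * (y \<bullet> c) + (x \<bullet> d) * (y \<bullet> d)"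
    and om: "orthogonal_matrix (vector [a, b, c, d] :: real^4^4)" for x y
    using fr orthonormal_inner_expand by blast+
  \<comment> \<open>An orthogonal matrix has determinant 1 or -1; positivity of the frame selects
    1.\<close>
  have det1: "det (vector [a, b, c, d] :: real^4^4) = 1"
    using det_orthogonal_matrix[OF om] fr by auto
  have det: "det (vector [v0 *\<^sub>R a + v1 *\<^sub>R b + v2 *\<^sub>R c + v3 *\<^sub>R d, a,
        k1 *\<^sub>R b + k2 *\<^sub>R c + k3 *\<^sub>R d, m0 *\<^sub>R a + m1 *\<^sub>R b + m2 *\<^sub>R c + m3 *\<^sub>R d] :: real^4^4)
      = v1 * (k3 * m2 - k2 * m3) + v2 * (k1 * m3 - k3 * m1) + v3 * (k2 * m1 - k1 * m2)" for v0 v1 v2 v3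
  proof -
    \<comment> \<open>The rows are the coordinates of the four vectors in the frame, so the
      determinant factors through that of the frame matrix.\<close>
    let ?M = "vector [vector [v0, v1, v2, v3], vector [1, 0, 0, 0], vector [0, k1, k2, k3],
        vector [m0, m1, m2, m3]] :: real^4^4"
    have "vector [v0 *\<^sub>R a + v1 *\<^sub>R b + v2 *\<^sub>R c + v3 *\<^sub>R d, a,
        k1 *\<^sub>R b + k2 *\<^sub>R c + k3 *\<^sub>R d, m0 *\<^sub>R a + m1 *\<^sub>R b + m2 *\<^sub>R c + m3 *\<^sub>R d]
        = ?M ** (vector [a, b, c, d] :: real^4^4)"
      by (simp add: vec_eq_iff forall_4 matrix_matrix_mult_def sum_4 vector_4)
    then have "det (vector [v0 *\<^sub>R a + v1 *\<^sub>R b + v2 *\<^sub>R c + v3 *\<^sub>R d, a,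
        k1 *\<^sub>R b + k2 *\<^sub>R c + k3 *\<^sub>R d, m0 *\<^sub>R a + m1 *\<^sub>R b + m2 *\<^sub>R c + m3 *\<^sub>R d] :: real^4^4) = det ?M"
      by (simp add: det_mul det1)
    also have "\<dots> = v1 * (k3 * m2 - k2 * m3) + v2 * (k1 * m3 - k3 * m1) + v3 * (k2 * m1 - k1 * m2)"
      unfolding det_4 vector_4 by (simp add: algebra_simps)
    finally show ?thesis .
  qed
  have eqI: "x = y" if "a \<bullet> x = a \<bullet> y" "b \<bullet> x = b \<bullet> y" "c \<bullet> x = c \<bullet> y" "d \<bullet> x = d \<bullet> y" for x y
  proof -
    have "z \<bullet> x = z \<bullet> y" for z
      unfolding expand[of z x] expand[of z y] inner_commute[of x] inner_commute[of y] using that by simp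
    then show ?thesis
      using vector_eq_ldot[of x y] by simp
  qed
  have "a \<bullet> ?l = a \<bullet> ?r" "b \<bullet> ?l = b \<bullet> ?r" "c \<bullet> ?l = c \<bullet> ?r" "d \<bullet> ?l = d \<bullet> ?r"
    unfolding inner_ternary_product
    using det[of 1 0 0 0] det[of 0 1 0 0] det[of 0 0 1 0] det[of 0 0 0 1]
    by (simp_all add: inner_add_right one zero)
  then show ?thesis
    by (rule eqI)
qed

subsection \<open>Gaussian curvature in an orthogonal parametrisation\<close>

lemma mem_normal_plane:
  "x \<in> normal_plane \<Psi> p \<longleftrightarrow> x \<bullet> partial_s \<Psi> p = 0 \<and> x \<bullet> partial_t \<Psi> p = 0"
proof
  assume "x \<in> normal_plane \<Psi> p"
  then show "x \<bullet> partial_s \<Psi> p = 0 \<and> x \<bullet> partial_t \<Psi> p = 0"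
    by (auto simp: normal_plane_def tangent_plane_def orthogonal_comp_def orthogonal_def span_base inner_commute[of x])
next
  assume x: "x \<bullet> partial_s \<Psi> p = 0 \<and> x \<bullet> partial_t \<Psi> p = 0"
  have "orthogonal x y" if "y \<in> span {partial_s \<Psi> p, partial_t \<Psi> p}" for y
    using that x by (intro orthogonal_to_span[of y "{partial_s \<Psi> p, partial_t \<Psi> p}"]) (auto simp: orthogonal_def)
  then show "x \<in> normal_plane \<Psi> p"
    by (simp add: normal_plane_def tangent_plane_def orthogonal_comp_def orthogonal_commute)
qed

lemma tangential_part_eq:
  assumes "norm (partial_s \<Psi> p) = 1" "partial_s \<Psi> p \<bullet> partial_t \<Psi> p = 0" "partial_t \<Psi> p \<noteq> 0"
  shows "tangential_part \<Psi> p x = (x \<bullet> partial_s \<Psi> p) *\<^sub>R partial_s \<Psi> p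
    + (x \<bullet> partial_t \<Psi> p / (partial_t \<Psi> p \<bullet> partial_t \<Psi> p)) *\<^sub>R partial_t \<Psi> p" (is "_ = ?y")
  unfolding tangential_part_def
proof (rule the_equality)
  have one: "partial_s \<Psi> p \<bullet> partial_s \<Psi> p = 1"
    using assms(1) by (simp add: norm_eq_1)
  have nz: "partial_t \<Psi> p \<bullet> partial_t \<Psi> p \<noteq> 0"
    using assms(3) by simp
  have "?y \<in> tangent_plane \<Psi> p"
    unfolding tangent_plane_def by (intro span_add span_scale span_base) simp_all
  moreover have "x - ?y \<in> normal_plane \<Psi> p"
    using assms(2) one nz unfolding mem_normal_plane
    by (simp add: inner_diff_left inner_add_left inner_commute[of "partial_t \<Psi> p" "partial_s \<Psi> p"])
  ultimately have y: "?y \<in> tangent_plane \<Psi> p" "x - ?y \<in> normal_plane \<Psi> p"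
    by simp_all
  then show "?y \<in> tangent_plane \<Psi> p \<and> x - ?y \<in> normal_plane \<Psi> p" by simp
  \<comment> \<open>Uniqueness: the difference of two candidates is both tangent and normal, hence
    orthogonal to itself.\<close>
  fix z assume z: "z \<in> tangent_plane \<Psi> p \<and> x - z \<in> normal_plane \<Psi> p"
  have "z - ?y \<in> tangent_plane \<Psi> p"
    using z y by (auto simp: tangent_plane_def intro: span_diff)
  moreover have "z - ?y \<in> normal_plane \<Psi> p"
    using z y(2) unfolding mem_normal_plane by (auto simp: inner_diff_left)
  ultimately have "(z - ?y) \<bullet> (z - ?y) = 0"
    by (auto simp: normal_plane_def orthogonal_comp_def orthogonal_def)
  then show "z = ?y" by simp
qed

lemma det_plane_matrix:
  assumes "b1 \<bullet> b2 = 0" "b1 \<noteq> 0" "b2 \<noteq> 0"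
    and "f b1 = \<alpha> *\<^sub>R b1 + \<beta> *\<^sub>R b2" "f b2 = \<gamma> *\<^sub>R b1 + \<delta> *\<^sub>R b2"
  shows "det (plane_matrix b1 b2 f) = \<alpha> * \<delta> - \<gamma> * \<beta>"
proof -
  have uniq: "a = a' \<and> b = b'" if "a *\<^sub>R b1 + b *\<^sub>R b2 = a' *\<^sub>R b1 + b' *\<^sub>R b2" for a b a' b'
    using arg_cong[OF that, of "\<lambda>x. x \<bullet> b1"] arg_cong[OF that, of "\<lambda>x. x \<bullet> b2"] assms(1-3)
    by (simp add: inner_add_left inner_commute[of b2 b1])
  let ?M = "vector [vector [\<alpha>, \<gamma>], vector [\<beta>, \<delta>]] :: real^2^2"
  have "plane_matrix b1 b2 f = ?M"
    unfolding plane_matrix_def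
  proof (rule the_equality)
    fix M :: "real^2^2"
    assume "f b1 = M$1$1 *\<^sub>R b1 + M$2$1 *\<^sub>R b2 \<and> f b2 = M$1$2 *\<^sub>R b1 + M$2$2 *\<^sub>R b2"
    then have "M$1$1 = \<alpha> \<and> M$2$1 = \<beta>" "M$1$2 = \<gamma> \<and> M$2$2 = \<delta>"
      using assms(4,5) by (auto intro!: uniq)
    then show "M = ?M"
      by (simp add: vec_eq_iff forall_2)
  qed (use assms in simp)
  then show ?thesis
    by (simp add: det_2)
qed

text \<open>Moves a derivative from one factor to the other. With \<open>c = 0\<close> it turns
  derivatives of a normal field into second derivatives of the surface; it also gives the
  skew-symmetry of the derivatives of an orthonormal frame.\<close>

lemma inner_partial_of_const:
  fixes N X :: "real \<times> real \<Rightarrow> 'a::real_inner"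
  assumes "open V" "p \<in> V" "\<And>q. q \<in> V \<Longrightarrow> N q \<bullet> X q = c"
    and "N differentiable (at p)" "X differentiable (at p)"
  shows "partial_s N p \<bullet> X p = - (N p \<bullet> partial_s X p)"
    and "partial_t N p \<bullet> X p = - (N p \<bullet> partial_t X p)"
proof -
  have "partial_s (\<lambda>x. N x \<bullet> X x) p = 0" "partial_t (\<lambda>x. N x \<bullet> X x) p = 0"
    using partial_cong(1,2)[OF assms(1,2), of "\<lambda>x. c" "\<lambda>x. N x \<bullet> X x"] assms(3)
      partial_eqI[OF has_derivative_const[of c]] by auto
  then show "partial_s N p \<bullet> X p = - (N p \<bullet> partial_s X p)"
    "partial_t N p \<bullet> X p = - (N p \<bullet> partial_t X p)"
    using partial_inner(1,2)[OF assms(4,5)] by auto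
qed

text \<open>Determinant of the second fundamental form in direction \<open>N\<close> divided by that
  of the first, whose coefficients are 1, 0 and the squared length of
  \<open>partial_t \<Psi> p\<close>.\<close>

lemma det_shape_operator_eq:
  assumes "open U" "smooth_on U \<Psi>" "p \<in> U"
    and unit: "norm (partial_s \<Psi> p) = 1" and orth: "partial_s \<Psi> p \<bullet> partial_t \<Psi> p = 0"
    and nz: "partial_t \<Psi> p \<noteq> 0"
    and "open V" "p \<in> V" "smooth_on V N" and N: "\<And>q. q \<in> V \<Longrightarrow> N q \<in> normal_plane \<Psi> q"
  shows "det_shape_operator \<Psi> N p =
    ((N p \<bullet> partial_s (partial_s \<Psi>) p) * (N p \<bullet> partial_t (partial_t \<Psi>) p)
      - (N p \<bullet> partial_t (partial_s \<Psi>) p)\<^sup>2) / (partial_t \<Psi> p \<bullet> partial_t \<Psi> p)"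
proof -
  let ?u = "partial_s \<Psi> p" and ?w = "partial_t \<Psi> p"
  let ?g = "?w \<bullet> ?w"
  let ?D = "frechet_derivative \<Psi> (at p)"
  have one: "?u \<bullet> ?u = 1" and nz': "?g \<noteq> 0"
    using unit nz by (simp_all add: norm_eq_1)
  have hD: "(\<Psi> has_derivative ?D) (at p)"
    by (rule smooth_on_has_derivative[OF assms(2,3)])
  then have lin: "linear ?D" using has_derivative_linear by blast
  have D: "?D (1, 0) = ?u" "?D (0, 1) = ?w"
    using partial_eqI[OF hD] by auto
  have Dhk: "?D (h, k) = h *\<^sub>R ?u + k *\<^sub>R ?w" for h k
    using linear_add[OF lin, of "h *\<^sub>R (1, 0)" "k *\<^sub>R (0, 1)"]
    by (simp only: linear_scale[OF lin] D) simp
  \<comment> \<open>The differential is injective because its columns are orthogonal and non-zero.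
    Hence \<open>inv\<close> in \<open>shape_operator\<close> takes the two tangent vectors back to
    the coordinate directions.\<close>
  have "inj ?D"
  proof (rule linear_injective_0[OF lin, THEN iffD2], intro allI impI)
    fix v assume v: "?D v = 0"
    then have "?D v \<bullet> ?u = 0" "?D v \<bullet> ?w = 0" by simp_all
    then show "v = 0"
      using Dhk[of "fst v" "snd v"] one nz' orth by (cases v) (auto simp: zero_prod_def inner_add_left inner_commute[of ?w ?u])
  qed
  then have inv: "inv ?D ?u = (1, 0)" "inv ?D ?w = (0, 1)"
    using D inv_f_f by metis+
  have hN: "(N has_derivative frechet_derivative N (at p)) (at p)"
    by (rule smooth_on_has_derivative[OF assms(9,8)])
  have dN: "N differentiable (at p)"
    using hN by (auto simp: differentiable_def)
  note sm = smooth_on_partial[OF assms(1,2)]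
  note dX = sm[THEN smooth_on_differentiable, OF assms(3)]
  have perp: "N q \<bullet> partial_s \<Psi> q = 0" "N q \<bullet> partial_t \<Psi> q = 0" if "q \<in> V" for q
    using N[OF that] by (auto simp: mem_normal_plane)
  note I = inner_partial_of_const[OF assms(7,8) perp(1) dN dX(1)] inner_partial_of_const[OF assms(7,8) perp(2) dN dX(2)]
  have "shape_operator \<Psi> N p ?u = - tangential_part \<Psi> p (partial_s N p)"
    "shape_operator \<Psi> N p ?w = - tangential_part \<Psi> p (partial_t N p)"
    by (simp_all add: shape_operator_def inv partial_eqI[OF hN])
  then have S: "shape_operator \<Psi> N p ?u = (N p \<bullet> partial_s (partial_s \<Psi>) p) *\<^sub>R ?u
      + ((N p \<bullet> partial_s (partial_t \<Psi>) p) / ?g) *\<^sub>R ?w"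
    "shape_operator \<Psi> N p ?w = (N p \<bullet> partial_t (partial_s \<Psi>) p) *\<^sub>R ?u
      + ((N p \<bullet> partial_t (partial_t \<Psi>) p) / ?g) *\<^sub>R ?w"
    by (simp_all add: tangential_part_eq[OF unit orth nz] I)
  have "?u \<noteq> 0" using one by auto
  show ?thesis
    unfolding det_shape_operator_def det_plane_matrix[OF orth \<open>?u \<noteq> 0\<close> nz S]
      partial_commute[OF assms(1-3)]
    by (simp add: power2_eq_square diff_divide_distrib)
qed

text \<open>The Gauss equation. Here \<open>perp\<close> is the inner product of the normal
  components, and it makes no reference to the normal frame.\<close>

lemma normal_frame_curvature:
  assumes "open U" "smooth_on U \<Psi>" "p \<in> U"
    and unit: "norm (partial_s \<Psi> p) = 1" and orth: "partial_s \<Psi> p \<bullet> partial_t \<Psi> p = 0"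
    and nz: "partial_t \<Psi> p \<noteq> 0"
    and "open V" "p \<in> V" "orthonormal_normal_frame V \<Psi> N1 N2"
  defines "perp \<equiv> \<lambda>x y. x \<bullet> y - (x \<bullet> partial_s \<Psi> p) * (y \<bullet> partial_s \<Psi> p)
      - (x \<bullet> partial_t \<Psi> p) * (y \<bullet> partial_t \<Psi> p) / (partial_t \<Psi> p \<bullet> partial_t \<Psi> p)"
  shows "det_shape_operator \<Psi> N1 p + det_shape_operator \<Psi> N2 p =
    (perp (partial_s (partial_s \<Psi>) p) (partial_t (partial_t \<Psi>) p)
      - perp (partial_t (partial_s \<Psi>) p) (partial_t (partial_s \<Psi>) p)) / (partial_t \<Psi> p \<bullet> partial_t \<Psi> p)"
proof -
  let ?u = "partial_s \<Psi> p" and ?w = "partial_t \<Psi> p"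
  note fr = assms(9)[unfolded orthonormal_normal_frame_def]
  have n: "norm ?w > 0" using nz by simp
  have "?u \<bullet> (?w /\<^sub>R norm ?w) = 0" "norm (?w /\<^sub>R norm ?w) = 1"
    "?u \<bullet> N1 p = 0" "?u \<bullet> N2 p = 0" "(?w /\<^sub>R norm ?w) \<bullet> N1 p = 0" "(?w /\<^sub>R norm ?w) \<bullet> N2 p = 0"
    "norm (N1 p) = 1" "norm (N2 p) = 1" "N1 p \<bullet> N2 p = 0"
    using fr assms(8) orth n by (auto simp: mem_normal_plane inner_commute)
  \<comment> \<open>The unit tangent vectors together with \<open>N1 p\<close> and
    \<open>N2 p\<close> form an orthonormal basis, so subtracting the tangential terms leaves
    exactly the \<open>N1\<close> and \<open>N2\<close> terms.\<close>
  note ex = orthonormal_inner_expand(1)[OF unit this(2,7,8,1,3,4,5,6,9)]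
  have "perp x y = (N1 p \<bullet> x) * (N1 p \<bullet> y) + (N2 p \<bullet> x) * (N2 p \<bullet> y)" for x y
    unfolding perp_def ex[of x y] using n
    by (simp add: inner_commute dot_square_norm power2_eq_square field_simps)
  moreover have "det_shape_operator \<Psi> N p =
    ((N p \<bullet> partial_s (partial_s \<Psi>) p) * (N p \<bullet> partial_t (partial_t \<Psi>) p)
      - (N p \<bullet> partial_t (partial_s \<Psi>) p)\<^sup>2) / (?w \<bullet> ?w)" if "N = N1 \<or> N = N2" for N
    using fr that by (intro det_shape_operator_eq[OF assms(1-8)]) auto
  ultimately show ?thesis
    by (simp add: add_divide_distrib diff_divide_distrib power2_eq_square)
qed

text \<open>The value found for an arbitrary local frame does not involve the frame, which gives
  uniqueness for the definite description; the given frame on \<open>U\<close> gives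
  existence.\<close>

lemma gaussian_curvature_eq:
  assumes "open U" "smooth_on U \<Psi>" "p \<in> U"
    and "norm (partial_s \<Psi> p) = 1" "partial_s \<Psi> p \<bullet> partial_t \<Psi> p = 0" "partial_t \<Psi> p \<noteq> 0"
    and "orthonormal_normal_frame U \<Psi> N1 N2"
  defines "perp \<equiv> \<lambda>x y. x \<bullet> y - (x \<bullet> partial_s \<Psi> p) * (y \<bullet> partial_s \<Psi> p)
      - (x \<bullet> partial_t \<Psi> p) * (y \<bullet> partial_t \<Psi> p) / (partial_t \<Psi> p \<bullet> partial_t \<Psi> p)"
  shows "gaussian_curvature \<Psi> p =
    (perp (partial_s (partial_s \<Psi>) p) (partial_t (partial_t \<Psi>) p)
      - perp (partial_t (partial_s \<Psi>) p) (partial_t (partial_s \<Psi>) p)) / (partial_t \<Psi> p \<bullet> partial_t \<Psi> p)"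
  unfolding gaussian_curvature_def perp_def
  using assms(7) normal_frame_curvature[OF assms(1-6)]
    normal_frame_curvature[OF assms(1-6) assms(1,3,7)] assms(1,3)
  by (intro the_equality) metis+

subsection \<open>Soliton surfaces in a parallel transport frame\<close>

text \<open>The condition \<open>nondegenerate\<close> amounts to \<open>partial_t \<Psi>\<close>
  vanishing nowhere, so that the surface is immersed.\<close>

locale soliton_surface =
  fixes U :: "(real \<times> real) set" and \<Psi> T P1 P2 P3 :: "real \<times> real \<Rightarrow> real^4"
    and k1 k2 k3 :: "real \<times> real \<Rightarrow> real"
  assumes open_U: "open U" and smooth_surface: "smooth_on U \<Psi>" and soliton: "betchov_da_rios U \<Psi>"
    and frame: "parallel_transport_frame U \<Psi> T P1 P2 P3 k1 k2 k3"
    and nondegenerate: "\<And>p. p \<in> U \<Longrightarrow>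
      \<not> (P_fun k1 k2 k3 p = 0 \<and> R_fun k1 k2 k3 p = 0 \<and> S_fun k1 k2 k3 p = 0)"
begin

text \<open>Coordinates of \<^term>\<open>partial_t \<Psi>\<close> in the frame (\<open>partial_t_surface\<close>).\<close>

abbreviation "w1 \<equiv> P_fun k1 k2 k3"
abbreviation "w2 \<equiv> R_fun k1 k2 k3"
abbreviation "w3 \<equiv> S_fun k1 k2 k3"

text \<open>Normal to the \<open>s\<close>-parameter curves, not to the surface:
  \<open>partial_t \<Psi>\<close> itself has this form. Vectors orthogonal to \<open>T\<close> are
  thereby identified with coefficient triples.\<close>

definition normal_field ::
  "(real \<times> real \<Rightarrow> real) \<Rightarrow> (real \<times> real \<Rightarrow> real) \<Rightarrow> (real \<times> real \<Rightarrow> real) \<Rightarrow> real \<times> real \<Rightarrow> real^4" where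
  "normal_field c1 c2 c3 p = c1 p *\<^sub>R P1 p + c2 p *\<^sub>R P2 p + c3 p *\<^sub>R P3 p"

lemma frame_smooth: "smooth_on U T" "smooth_on U P1" "smooth_on U P2" "smooth_on U P3"
  using frame by (auto simp: parallel_transport_frame_def)

lemmas frame_differentiable = frame_smooth[THEN smooth_on_differentiable]

lemma frame_positive: "p \<in> U \<Longrightarrow> positive_orthonormal_frame (T p) (P1 p) (P2 p) (P3 p)"
  using frame by (auto simp: parallel_transport_frame_def)

lemma frame_inner:
  assumes "p \<in> U"
  shows "T p \<bullet> T p = 1" "P1 p \<bullet> P1 p = 1" "P2 p \<bullet> P2 p = 1" "P3 p \<bullet> P3 p = 1"
    "T p \<bullet> P1 p = 0" "T p \<bullet> P2 p = 0" "T p \<bullet> P3 p = 0"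
    "P1 p \<bullet> P2 p = 0" "P1 p \<bullet> P3 p = 0" "P2 p \<bullet> P3 p = 0"
    "P1 p \<bullet> T p = 0" "P2 p \<bullet> T p = 0" "P3 p \<bullet> T p = 0"
    "P2 p \<bullet> P1 p = 0" "P3 p \<bullet> P1 p = 0" "P3 p \<bullet> P2 p = 0"
  using frame_positive[OF assms]
  by (simp_all add: positive_orthonormal_frame_def norm_eq_1 inner_commute)

lemma partial_s_frame:
  assumes "p \<in> U"
  shows "partial_s \<Psi> p = T p" "partial_s T p = normal_field k1 k2 k3 p"
    "partial_s P1 p = - k1 p *\<^sub>R T p" "partial_s P2 p = - k2 p *\<^sub>R T p" "partial_s P3 p = - k3 p *\<^sub>R T p"
  using frame assms by (auto simp: parallel_transport_frame_def normal_field_def)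

lemma inner_normal_field:
  assumes "p \<in> U"
  shows "normal_field c1 c2 c3 p \<bullet> T p = 0" "T p \<bullet> normal_field c1 c2 c3 p = 0"
    and "normal_field c1 c2 c3 p \<bullet> normal_field d1 d2 d3 p = c1 p * d1 p + c2 p * d2 p + c3 p * d3 p"
  using frame_inner[OF assms] by (simp_all add: normal_field_def inner_add_left inner_add_right)

text \<open>The curvature functions are recovered as inner products of \<open>partial_s T\<close>
  with the smooth frame fields.\<close>

lemma curvature_smooth: "smooth_on U k1" "smooth_on U k2" "smooth_on U k3"
proof -
  have k: "partial_s T p \<bullet> P1 p = k1 p" "partial_s T p \<bullet> P2 p = k2 p" "partial_s T p \<bullet> P3 p = k3 p"
    if "p \<in> U" for p
    using frame_inner[OF that] partial_s_frame(2)[OF that] by (simp_all add: normal_field_def inner_add_left)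
  note sm = smooth_on_inner[OF open_U smooth_on_partial(1)[OF open_U frame_smooth(1)]]
  show "smooth_on U k1" "smooth_on U k2" "smooth_on U k3"
    by (rule smooth_on_cong[OF open_U k(1) sm[OF frame_smooth(2)]] smooth_on_cong[OF open_U k(2) sm[OF frame_smooth(3)]]
        smooth_on_cong[OF open_U k(3) sm[OF frame_smooth(4)]]; assumption)+
qed

lemmas curvature_partial_smooth = curvature_smooth[THEN smooth_on_partial(1)[OF open_U]]

lemma binormal_smooth: "smooth_on U w1" "smooth_on U w2" "smooth_on U w3"
proof -
  have "w1 = (\<lambda>p. k3 p * partial_s k2 p - k2 p * partial_s k3 p)"
    "w2 = (\<lambda>p. k1 p * partial_s k3 p - k3 p * partial_s k1 p)"
    "w3 = (\<lambda>p. k2 p * partial_s k1 p - k1 p * partial_s k2 p)"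
    by (auto simp: P_fun_def R_fun_def S_fun_def)
  then show "smooth_on U w1" "smooth_on U w2" "smooth_on U w3"
    by (auto intro!: smooth_on_diff smooth_on_mult open_U curvature_smooth curvature_partial_smooth)
qed

text \<open>Differentiating the cross product of \<open>k\<^sub>s\<close> and \<open>k\<close>
  leaves that of \<open>k\<^sub>s\<^sub>s\<close> and \<open>k\<close>, since the products of first
  derivatives cancel.\<close>

lemma partial_s_binormal:
  assumes "p \<in> U"
  shows "partial_s w1 p = k3 p * partial_s (partial_s k2) p - k2 p * partial_s (partial_s k3) p"
    and "partial_s w2 p = k1 p * partial_s (partial_s k3) p - k3 p * partial_s (partial_s k1) p"
    and "partial_s w3 p = k2 p * partial_s (partial_s k1) p - k1 p * partial_s (partial_s k2) p"
proof -
  have eq: "w1 = (\<lambda>p. k3 p * partial_s k2 p - k2 p * partial_s k3 p)"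
    "w2 = (\<lambda>p. k1 p * partial_s k3 p - k3 p * partial_s k1 p)"
    "w3 = (\<lambda>p. k2 p * partial_s k1 p - k1 p * partial_s k2 p)"
    by (auto simp: P_fun_def R_fun_def S_fun_def)
  note d = curvature_smooth[THEN smooth_on_differentiable, OF assms]
    curvature_partial_smooth[THEN smooth_on_differentiable, OF assms]
  show "partial_s w1 p = k3 p * partial_s (partial_s k2) p - k2 p * partial_s (partial_s k3) p"
    "partial_s w2 p = k1 p * partial_s (partial_s k3) p - k3 p * partial_s (partial_s k1) p"
    "partial_s w3 p = k2 p * partial_s (partial_s k1) p - k1 p * partial_s (partial_s k2) p"
    unfolding eq by (simp_all add: partial_diff(1) partial_mult d)
qed

lemma binormal_orthogonal: "w1 p * k1 p + w2 p * k2 p + w3 p * k3 p = 0"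
  by (simp add: P_fun_def R_fun_def S_fun_def algebra_simps)

lemma normal_field_smooth:
  "smooth_on U c1 \<Longrightarrow> smooth_on U c2 \<Longrightarrow> smooth_on U c3 \<Longrightarrow> smooth_on U (normal_field c1 c2 c3)"
  unfolding normal_field_def[abs_def]
  by (intro smooth_on_add smooth_on_scaleR open_U frame_smooth)

text \<open>In the \<open>s\<close> direction the derivatives of the frame fields are tangential and
  contribute only a multiple of \<open>T\<close>; in the \<open>t\<close> direction they are kept as
  they are.\<close>

lemma partial_normal_field:
  assumes "smooth_on U c1" "smooth_on U c2" "smooth_on U c3" "p \<in> U"
  shows "partial_s (normal_field c1 c2 c3) p =
      normal_field (partial_s c1) (partial_s c2) (partial_s c3) p
        - (c1 p * k1 p + c2 p * k2 p + c3 p * k3 p) *\<^sub>R T p"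
    and "partial_t (normal_field c1 c2 c3) p =
      normal_field (partial_t c1) (partial_t c2) (partial_t c3) p
        + (c1 p *\<^sub>R partial_t P1 p + c2 p *\<^sub>R partial_t P2 p + c3 p *\<^sub>R partial_t P3 p)"
proof -
  note d = assms(1-3)[THEN smooth_on_differentiable, OF assms(4)] frame_differentiable[OF assms(4)]
  show "partial_s (normal_field c1 c2 c3) p =
      normal_field (partial_s c1) (partial_s c2) (partial_s c3) p
        - (c1 p * k1 p + c2 p * k2 p + c3 p * k3 p) *\<^sub>R T p"
    "partial_t (normal_field c1 c2 c3) p =
      normal_field (partial_t c1) (partial_t c2) (partial_t c3) p
        + (c1 p *\<^sub>R partial_t P1 p + c2 p *\<^sub>R partial_t P2 p + c3 p *\<^sub>R partial_t P3 p)"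
    unfolding normal_field_def[abs_def]
    by (simp_all add: partial_add differentiable_add partial_scaleR d partial_s_frame[OF assms(4)] algebra_simps)
qed

section \<open>Derivatives of the soliton surface in frame coordinates\<close>

lemma partial_ss:
  assumes "p \<in> U"
  shows "partial_s (partial_s \<Psi>) p = normal_field k1 k2 k3 p"
  using partial_cong(1)[OF open_U assms partial_s_frame(1)[symmetric] frame_differentiable(1)[OF assms]]
    partial_s_frame(2)[OF assms] by simp

lemma partial_sss:
  assumes "p \<in> U"
  shows "partial_s (partial_s (partial_s \<Psi>)) p =
    normal_field (partial_s k1) (partial_s k2) (partial_s k3) p
      - (k1 p * k1 p + k2 p * k2 p + k3 p * k3 p) *\<^sub>R T p"
  using partial_cong(1)[OF open_U assms partial_ss[symmetric]
      smooth_on_differentiable[OF normal_field_smooth[OF curvature_smooth] assms]]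
    partial_normal_field(1)[OF curvature_smooth assms] by simp

lemma partial_t_surface:
  assumes "p \<in> U"
  shows "partial_t \<Psi> p = normal_field w1 w2 w3 p"
proof -
  have "partial_t \<Psi> p = ternary_product (T p) (normal_field k1 k2 k3 p)
      (normal_field (partial_s k1) (partial_s k2) (partial_s k3) p
        - (k1 p * k1 p + k2 p * k2 p + k3 p * k3 p) *\<^sub>R T p)"
    using soliton assms partial_s_frame(1)[OF assms] partial_ss[OF assms] partial_sss[OF assms]
    by (simp add: betchov_da_rios_def)
  also have "\<dots> = normal_field w1 w2 w3 p"
    using ternary_product_in_frame[OF frame_positive[OF assms], of "k1 p" "k2 p" "k3 p"
        "- (k1 p * k1 p + k2 p * k2 p + k3 p * k3 p)" "partial_s k1 p" "partial_s k2 p" "partial_s k3 p"]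
    by (simp add: normal_field_def P_fun_def R_fun_def S_fun_def algebra_simps)
  finally show ?thesis .
qed

text \<open>After exchanging the derivatives, the field with coordinates \<open>w\<close> is
  differentiated along \<open>s\<close>; its \<open>T\<close>-component is minus the inner product
  of \<open>w\<close> and \<open>k\<close>, which vanishes.\<close>

lemma partial_ts:
  assumes "p \<in> U"
  shows "partial_t (partial_s \<Psi>) p = normal_field (partial_s w1) (partial_s w2) (partial_s w3) p"
  using partial_commute[OF open_U smooth_surface assms]
    partial_cong(1)[OF open_U assms partial_t_surface[symmetric]
      smooth_on_differentiable[OF normal_field_smooth[OF binormal_smooth] assms]]
    partial_normal_field(1)[OF binormal_smooth assms] binormal_orthogonal by simp

lemma partial_tt:
  assumes "p \<in> U"
  shows "partial_t (partial_t \<Psi>) p = normal_field (partial_t w1) (partial_t w2) (partial_t w3) p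
    + (w1 p *\<^sub>R partial_t P1 p + w2 p *\<^sub>R partial_t P2 p + w3 p *\<^sub>R partial_t P3 p)"
  using partial_cong(2)[OF open_U assms partial_t_surface[symmetric]
      smooth_on_differentiable[OF normal_field_smooth[OF binormal_smooth] assms]]
    partial_normal_field(2)[OF binormal_smooth assms] by simp

lemma inner_partial_t_frame:
  assumes "p \<in> U"
  shows "partial_t P1 p \<bullet> P1 p = 0" "partial_t P2 p \<bullet> P2 p = 0" "partial_t P3 p \<bullet> P3 p = 0"
    "partial_t P2 p \<bullet> P1 p = - (partial_t P1 p \<bullet> P2 p)"
    "partial_t P3 p \<bullet> P1 p = - (partial_t P1 p \<bullet> P3 p)"
    "partial_t P3 p \<bullet> P2 p = - (partial_t P2 p \<bullet> P3 p)"
proof -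
  have const: "partial_t X p \<bullet> Y p = - (partial_t Y p \<bullet> X p)"
    if "\<And>q. q \<in> U \<Longrightarrow> X q \<bullet> Y q = c" "smooth_on U X" "smooth_on U Y"
    for X Y :: "real \<times> real \<Rightarrow> real^4" and c
    using inner_partial_of_const(2)[OF open_U assms that(1) that(2,3)[THEN smooth_on_differentiable, OF assms]]
    by (simp add: inner_commute)
  show "partial_t P1 p \<bullet> P1 p = 0" "partial_t P2 p \<bullet> P2 p = 0" "partial_t P3 p \<bullet> P3 p = 0"
    using const[of P1 P1, OF frame_inner(2)] const[of P2 P2, OF frame_inner(3)]
      const[of P3 P3, OF frame_inner(4)] frame_smooth by auto
  show "partial_t P2 p \<bullet> P1 p = - (partial_t P1 p \<bullet> P2 p)"
    "partial_t P3 p \<bullet> P1 p = - (partial_t P1 p \<bullet> P3 p)"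
    "partial_t P3 p \<bullet> P2 p = - (partial_t P2 p \<bullet> P3 p)"
    using const[of P2 P1, OF frame_inner(14)] const[of P3 P1, OF frame_inner(15)]
      const[of P3 P2, OF frame_inner(16)] frame_smooth by auto
qed

text \<open>Differentiating the orthogonality of \<open>w\<close> and \<open>k\<close> shifts the
  \<open>t\<close>-derivative from \<open>w\<close> to \<open>k\<close>, the form in which it enters
  \<open>A_fun\<close>.\<close>

lemma partial_t_binormal_orthogonal:
  assumes "p \<in> U"
  shows "partial_t w1 p * k1 p + partial_t w2 p * k2 p + partial_t w3 p * k3 p =
    - (w1 p * partial_t k1 p + w2 p * partial_t k2 p + w3 p * partial_t k3 p)"
proof -
  note d = curvature_smooth[THEN smooth_on_differentiable, OF assms]
    binormal_smooth[THEN smooth_on_differentiable, OF assms]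
  have "partial_t (\<lambda>p. w1 p * k1 p + w2 p * k2 p + w3 p * k3 p) p = 0"
    unfolding binormal_orthogonal by (rule partial_eqI(2)[OF has_derivative_const])
  moreover have "partial_t (\<lambda>p. w1 p * k1 p + w2 p * k2 p + w3 p * k3 p) p =
      w1 p * partial_t k1 p + partial_t w1 p * k1 p + (w2 p * partial_t k2 p + partial_t w2 p * k2 p)
        + (w3 p * partial_t k3 p + partial_t w3 p * k3 p)"
    by (simp add: partial_add partial_mult d)
  ultimately show ?thesis by linarith
qed

lemma inner_ss_tt:
  assumes "p \<in> U"
  shows "partial_s (partial_s \<Psi>) p \<bullet> partial_t (partial_t \<Psi>) p = A_fun P1 P2 P3 k1 k2 k3 p"
proof -
  have "partial_s (partial_s \<Psi>) p \<bullet> partial_t (partial_t \<Psi>) p =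
      (partial_t w1 p * k1 p + partial_t w2 p * k2 p + partial_t w3 p * k3 p)
      + (w1 p *\<^sub>R partial_t P1 p + w2 p *\<^sub>R partial_t P2 p + w3 p *\<^sub>R partial_t P3 p) \<bullet> normal_field k1 k2 k3 p"
    unfolding partial_ss[OF assms] partial_tt[OF assms] inner_add_right inner_normal_field(3)[OF assms]
    by (simp add: inner_commute inner_add_left algebra_simps)
  \<comment> \<open>The first bracket gives the three terms with \<open>t\<close>-derivatives of the
    curvatures. In the second, skew-symmetry collects the nine frame products into the three
    coefficients of \<open>A_fun\<close>.\<close>
  also have "\<dots> = A_fun P1 P2 P3 k1 k2 k3 p"
    unfolding partial_t_binormal_orthogonal[OF assms]
    by (simp add: A_fun_def Let_def normal_field_def inner_add_left inner_add_right
        inner_partial_t_frame[OF assms] algebra_simps)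
  finally show ?thesis .
qed

section \<open>A global orthonormal frame of the normal bundle\<close>

lemma curvature_pos: "p \<in> U \<Longrightarrow> k1 p * k1 p + k2 p * k2 p + k3 p * k3 p > 0"
  and binormal_pos: "p \<in> U \<Longrightarrow> w1 p * w1 p + w2 p * w2 p + w3 p * w3 p > 0"
proof -
  have pos: "a * a + b * b + c * c > 0 \<longleftrightarrow> \<not> (a = 0 \<and> b = 0 \<and> c = 0)" for a b c :: real
    by (smt (verit, best) mult_eq_0_iff zero_le_square)
  assume p: "p \<in> U"
  from nondegenerate[OF p] show "w1 p * w1 p + w2 p * w2 p + w3 p * w3 p > 0"
    by (simp only: pos not_False_eq_True)
  \<comment> \<open>If \<open>k\<close> vanished at \<open>p\<close>, so would every component of
    \<open>w\<close>.\<close>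
  from nondegenerate[OF p] show "k1 p * k1 p + k2 p * k2 p + k3 p * k3 p > 0"
    unfolding pos by (auto simp: P_fun_def R_fun_def S_fun_def)
qed

lemma exists_normal_frame: "\<exists>N1 N2. orthonormal_normal_frame U \<Psi> N1 N2"
proof -
  \<comment> \<open>The factors are \<open>1/Q\<close> and \<open>1/(Q W)\<close>. The frame
    consists of \<open>k\<close> and the cross product of \<open>k\<close> and \<open>w\<close>,
    normalised; both are orthogonal to \<open>w\<close>, the coordinates of
    \<open>partial_t \<Psi>\<close>.\<close>
  let ?q = "\<lambda>p. inverse (sqrt (k1 p * k1 p + k2 p * k2 p + k3 p * k3 p))"
  let ?r = "\<lambda>p. ?q p * inverse (sqrt (w1 p * w1 p + w2 p * w2 p + w3 p * w3 p))"
  let ?N1 = "normal_field (\<lambda>p. ?q p * k1 p) (\<lambda>p. ?q p * k2 p) (\<lambda>p. ?q p * k3 p)"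
  let ?N2 = "normal_field (\<lambda>p. ?r p * (k2 p * w3 p - k3 p * w2 p))
    (\<lambda>p. ?r p * (k3 p * w1 p - k1 p * w3 p)) (\<lambda>p. ?r p * (k1 p * w2 p - k2 p * w1 p))"
  have q: "smooth_on U ?q"
    using curvature_pos
    by (intro smooth_on_inverse smooth_on_sqrt smooth_on_add smooth_on_mult open_U curvature_smooth) force+
  have "smooth_on U (\<lambda>p. inverse (sqrt (w1 p * w1 p + w2 p * w2 p + w3 p * w3 p)))"
    using binormal_pos
    by (intro smooth_on_inverse smooth_on_sqrt smooth_on_add smooth_on_mult open_U binormal_smooth) force+
  with q have r: "smooth_on U ?r"
    by (intro smooth_on_mult open_U)
  have "smooth_on U ?N1" "smooth_on U ?N2"
    by (intro normal_field_smooth smooth_on_mult smooth_on_diff open_U curvature_smooth binormal_smooth q r)+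
  moreover have "?N1 p \<in> normal_plane \<Psi> p \<and> ?N2 p \<in> normal_plane \<Psi> p \<and>
      norm (?N1 p) = 1 \<and> norm (?N2 p) = 1 \<and> ?N1 p \<bullet> ?N2 p = 0" if p: "p \<in> U" for p
  proof -
    define a where "a = k1 p * k1 p + k2 p * k2 p + k3 p * k3 p"
    define b where "b = w1 p * w1 p + w2 p * w2 p + w3 p * w3 p"
    note o = binormal_orthogonal[of p]
    have ab: "a > 0" "b > 0"
      using curvature_pos[OF p] binormal_pos[OF p] by (simp_all add: a_def b_def)
    have q2: "inverse (sqrt a) * inverse (sqrt a) * a = 1"
      and r2: "inverse (sqrt a) * inverse (sqrt a) * (inverse (sqrt b) * inverse (sqrt b)) * (a * b) = 1"
      using ab by (simp_all add: field_simps)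
    \<comment> \<open>Lagrange's identity for the squared length of the cross product; the
      subtracted square is zero because \<open>w\<close> and \<open>k\<close> are
      orthogonal.\<close>
    have lagrange: "(k2 p * w3 p - k3 p * w2 p) * (k2 p * w3 p - k3 p * w2 p)
        + (k3 p * w1 p - k1 p * w3 p) * (k3 p * w1 p - k1 p * w3 p)
        + (k1 p * w2 p - k2 p * w1 p) * (k1 p * w2 p - k2 p * w1 p)
        = a * b - (w1 p * k1 p + w2 p * k2 p + w3 p * k3 p)\<^sup>2"
      by (simp add: a_def b_def power2_eq_square algebra_simps)
    have "?N1 p \<bullet> partial_t \<Psi> p = ?q p * (w1 p * k1 p + w2 p * k2 p + w3 p * k3 p)"
      unfolding partial_t_surface[OF p] inner_normal_field(3)[OF p] by (simp add: algebra_simps)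
    moreover have "?N2 p \<bullet> partial_t \<Psi> p = 0"
      unfolding partial_t_surface[OF p] inner_normal_field(3)[OF p] by (simp add: algebra_simps)
    moreover have "?N1 p \<bullet> ?N1 p = inverse (sqrt a) * inverse (sqrt a) * a"
      unfolding inner_normal_field(3)[OF p] by (simp add: a_def algebra_simps)
    moreover have "?N2 p \<bullet> ?N2 p = inverse (sqrt a) * inverse (sqrt a) * (inverse (sqrt b) * inverse (sqrt b)) *
        ((k2 p * w3 p - k3 p * w2 p) * (k2 p * w3 p - k3 p * w2 p)
        + (k3 p * w1 p - k1 p * w3 p) * (k3 p * w1 p - k1 p * w3 p)
        + (k1 p * w2 p - k2 p * w1 p) * (k1 p * w2 p - k2 p * w1 p))"
      unfolding inner_normal_field(3)[OF p] a_def[symmetric] b_def[symmetric]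
      by (simp only: distrib_left mult.assoc mult.left_commute mult.commute)
    moreover have "?N1 p \<bullet> ?N2 p = 0"
      unfolding inner_normal_field(3)[OF p] by (simp add: algebra_simps)
    ultimately show ?thesis
      using q2 r2 o lagrange
      by (simp add: mem_normal_plane partial_s_frame(1)[OF p] inner_normal_field(1)[OF p] norm_eq_1)
  qed
  ultimately show ?thesis
    unfolding orthonormal_normal_frame_def by blast
qed

text \<open>In the Gauss equation only the \<open>partial_t \<Psi>\<close> component of the mixed
  derivative has to be removed: the other tangential components of it and of
  \<open>partial_s (partial_s \<Psi>)\<close> vanish. Multiplication by the fourth power of
  \<open>W_fun\<close> clears both denominators.\<close>

lemma gaussian_curvature_soliton:
  assumes "p \<in> U"
  shows "gaussian_curvature \<Psi> p * ((W_fun k1 k2 k3 p)\<^sup>2)\<^sup>2 =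
    A_fun P1 P2 P3 k1 k2 k3 p * (W_fun k1 k2 k3 p)\<^sup>2 - (Q_fun k1 k2 k3 p)\<^sup>2 * (C_fun k1 k2 k3 p)\<^sup>2"
proof -
  \<comment> \<open>In coordinates, \<open>g\<close> and \<open>v\<close> are the squared lengths of
    \<open>w\<close> and its \<open>s\<close>-derivative, and \<open>m\<close> is their inner
    product.\<close>
  define g where "g = w1 p * w1 p + w2 p * w2 p + w3 p * w3 p"
  define m where "m = partial_s w1 p * w1 p + partial_s w2 p * w2 p + partial_s w3 p * w3 p"
  define v where "v = partial_s w1 p * partial_s w1 p + partial_s w2 p * partial_s w2 p + partial_s w3 p * partial_s w3 p"
  have g: "g > 0" using binormal_pos[OF assms] by (simp add: g_def)
  have W: "(W_fun k1 k2 k3 p)\<^sup>2 = g"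
    using g by (simp add: W_fun_def g_def power2_eq_square)
  have Q: "(Q_fun k1 k2 k3 p)\<^sup>2 = k1 p * k1 p + k2 p * k2 p + k3 p * k3 p"
    using curvature_pos[OF assms] by (simp add: Q_fun_def power2_eq_square)
  have tt: "partial_t \<Psi> p \<bullet> partial_t \<Psi> p = g"
    unfolding partial_t_surface[OF assms] inner_normal_field(3)[OF assms] g_def ..
  have orth: "partial_s \<Psi> p \<bullet> partial_t \<Psi> p = 0"
    unfolding partial_t_surface[OF assms] partial_s_frame(1)[OF assms] by (rule inner_normal_field(2)[OF assms])
  have unit: "norm (partial_s \<Psi> p) = 1"
    using frame_inner(1)[OF assms] partial_s_frame(1)[OF assms] by (simp add: norm_eq_1)
  have nz: "partial_t \<Psi> p \<noteq> 0"
    using tt g by auto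
  obtain N1 N2 where N: "orthonormal_normal_frame U \<Psi> N1 N2"
    using exists_normal_frame by blast
  have i: "partial_s (partial_s \<Psi>) p \<bullet> partial_s \<Psi> p = 0" "partial_t (partial_s \<Psi>) p \<bullet> partial_s \<Psi> p = 0"
    "partial_s (partial_s \<Psi>) p \<bullet> partial_t \<Psi> p = 0" "partial_t (partial_s \<Psi>) p \<bullet> partial_t \<Psi> p = m"
    "partial_t (partial_s \<Psi>) p \<bullet> partial_t (partial_s \<Psi>) p = v"
    using binormal_orthogonal[of p]
    unfolding partial_ss[OF assms] partial_ts[OF assms] partial_t_surface[OF assms] partial_s_frame(1)[OF assms]
      inner_normal_field[OF assms] m_def v_def by (simp_all add: mult.commute)
  have K: "gaussian_curvature \<Psi> p = (A_fun P1 P2 P3 k1 k2 k3 p - (v - m * m / g)) / g"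
    using gaussian_curvature_eq[OF open_U smooth_surface assms unit orth nz N]
    by (simp add: i tt inner_ss_tt[OF assms])
  \<comment> \<open>Lagrange's identity: \<open>w\<close> and \<open>\<partial>w/\<partial>s\<close> are both orthogonal to \<open>k\<close>, so their cross product is a multiple of \<open>k\<close>.\<close>
  have "v * g - m * m = (k1 p * k1 p + k2 p * k2 p + k3 p * k3 p) * (C_fun k1 k2 k3 p)\<^sup>2"
    unfolding v_def m_def g_def C_fun_def partial_s_binormal[OF assms]
    unfolding P_fun_def R_fun_def S_fun_def power2_eq_square by algebra
  then show ?thesis
    unfolding W Q K using g by (simp add: power2_eq_square field_simps)
qed

end

theorem theorem4:
  fixes I J :: "real set"
    and \<Psi> T P\<^sub>1 P\<^sub>2 P\<^sub>3 :: "real \<times> real \<Rightarrow> real^4"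
    and k\<^sub>1 k\<^sub>2 k\<^sub>3 :: "real \<times> real \<Rightarrow> real"
  assumes "open_interval I" and "open_interval J"
    and "smooth_on (I \<times> J) \<Psi>"
    and "\<forall>p\<in>I \<times> J. norm (partial_s \<Psi> p) = 1"
    and "betchov_da_rios (I \<times> J) \<Psi>"
    and "parallel_transport_frame (I \<times> J) \<Psi> T P\<^sub>1 P\<^sub>2 P\<^sub>3 k\<^sub>1 k\<^sub>2 k\<^sub>3"
    and "nonzero_on (I \<times> J) k\<^sub>1 \<and> nonzero_on (I \<times> J) k\<^sub>2 \<or>
         nonzero_on (I \<times> J) k\<^sub>1 \<and> nonzero_on (I \<times> J) k\<^sub>3 \<or>
         nonzero_on (I \<times> J) k\<^sub>2 \<and> nonzero_on (I \<times> J) k\<^sub>3"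
    and "\<forall>p\<in>I \<times> J. \<not> (P_fun k\<^sub>1 k\<^sub>2 k\<^sub>3 p = 0 \<and> R_fun k\<^sub>1 k\<^sub>2 k\<^sub>3 p = 0 \<and> S_fun k\<^sub>1 k\<^sub>2 k\<^sub>3 p = 0)"
  shows "flat_surface (I \<times> J) \<Psi> \<longleftrightarrow>
    (\<forall>p\<in>I \<times> J. A_fun P\<^sub>1 P\<^sub>2 P\<^sub>3 k\<^sub>1 k\<^sub>2 k\<^sub>3 p * (W_fun k\<^sub>1 k\<^sub>2 k\<^sub>3 p)\<^sup>2 =
       (Q_fun k\<^sub>1 k\<^sub>2 k\<^sub>3 p)\<^sup>2 * (C_fun k\<^sub>1 k\<^sub>2 k\<^sub>3 p)\<^sup>2)"
proof -
  interpret soliton_surface "I \<times> J" \<Psi> T P\<^sub>1 P\<^sub>2 P\<^sub>3 k\<^sub>1 k\<^sub>2 k\<^sub>3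
    using assms by unfold_locales (auto simp: open_interval_def open_Times)
  have "gaussian_curvature \<Psi> p = 0 \<longleftrightarrow>
      A_fun P\<^sub>1 P\<^sub>2 P\<^sub>3 k\<^sub>1 k\<^sub>2 k\<^sub>3 p * (W_fun k\<^sub>1 k\<^sub>2 k\<^sub>3 p)\<^sup>2 = (Q_fun k\<^sub>1 k\<^sub>2 k\<^sub>3 p)\<^sup>2 * (C_fun k\<^sub>1 k\<^sub>2 k\<^sub>3 p)\<^sup>2"
    if p: "p \<in> I \<times> J" for p
  proof -
    \<comment> \<open>Since the fourth power of \<open>W_fun\<close> is non-zero, the curvature
      vanishes at \<open>p\<close> exactly when the right-hand side of the curvature identity
      does.\<close>
    have "W_fun k\<^sub>1 k\<^sub>2 k\<^sub>3 p \<noteq> 0"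
      using binormal_pos[OF p] by (simp add: W_fun_def power2_eq_square)
    then show ?thesis
      using gaussian_curvature_soliton[OF p] by auto
  qed
  then show ?thesis
    by (simp add: flat_surface_def)
qed

end
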